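(* Let $0<q<\tfrac{1}{2}$ and set $c=\tfrac{1}{2}-q$, so $0<c<\tfrac{1}{2}$. In the noisy two-cluster query model described in the context, there exists a polynomial-time algorithm that performs $\Theta\!\left(n \log n \,(2c)^{-\frac{\log n}{\log\log n}}\right)$ edge queries and, with high probability, recovers the clustering $(R,B)$, i.e. correctly determines for every pair of items $u,v\in[n]$ whether $f(u)=f(v)$.
   Context: Noisy two-cluster query model: $V=[n]$ is a set of $n$ items and $f:V\to\{\text{red},\text{blue}\}$ is an unknown function, with clusters $R=\{v: f(v)=\text{red}\}$ and $B=\{v:f(v)=\text{blue}\}$ (any sizes $0\le |R|\le n$ allowed). Only the clusters, not the labels, need to be recovered. An algorithm may query a pair of items $\{u,v\}$; the answer is meant to report whether $f(u)=f(v)$ (sign $+1$) or $f(u)\neq f(v)$ (sign $-1$), but independently for each queried pair the reported answer is the wrong one with probability $q$ and the correct one with probability $1-q$. The quantity $c=\tfrac12-q$ is called the gap. "With high probability" means with probability tending to $1$ as $n\to\infty$. *)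

theory Defs
  imports
    "HOL-Probability.Product_PMF"
    "HOL-Library.Landau_Symbols"
    "HOL-Computational_Algebra.Polynomial"
begin

text \<open>
  The noisy two-cluster query model. The items are \<open>{..<n}\<close>. The noise is drawn once for each
  unordered pair, so asking about the same pair again returns the same reply.
\<close>

datatype color = Red | Blue

definition item_pairs :: "nat \<Rightarrow> nat set set" where
  "item_pairs n = {{u, v} |u v. u < n \<and> v < n \<and> u \<noteq> v}"

definition noise :: "real \<Rightarrow> nat \<Rightarrow> (nat set \<Rightarrow> bool) pmf" where
  "noise q n = Pi_pmf (item_pairs n) False (\<lambda>_. bernoulli_pmf q)"

definition reply :: "(nat \<Rightarrow> color) \<Rightarrow> (nat set \<Rightarrow> bool) \<Rightarrow> nat \<Rightarrow> nat \<Rightarrow> bool" where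
  "reply f w u v \<longleftrightarrow> ((f u = f v) \<noteq> w {u, v})"

text \<open>
  Algorithms are programs of a probabilistic random access machine with unit cost per
  instruction. The only arithmetic operations are addition and truncated subtraction, so after
  \<open>t\<close> steps all stored numbers have \<open>O(t + log n)\<close> bits, and polynomial time on this machine is
  polynomial time in the usual sense. The instructions \<open>Query\<close>, \<open>Coin\<close> and \<open>Digit\<close> ask about a
  pair of items, toss a fair coin, and read the next binary digit of the error probability \<open>q\<close>.
  The last one is how the machine knows \<open>q\<close>, which is an arbitrary real number: a
  program without access to \<open>q\<close> could not choose the number of queries as a function of \<open>q\<close> when
  \<open>q\<close> is not computable.
\<close>

type_synonym reg = nat

datatype instr =
    Put reg nat
  | Add reg reg reg
  | Sub reg reg reg
  | Load reg reg
  | Store reg reg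
  | Query reg reg reg
  | Coin reg
  | Digit reg
  | Branch reg "instr list" "instr list"
  | Loop reg "instr list"

record state =
  regs :: "reg \<Rightarrow> nat"
  heap :: "nat \<Rightarrow> nat"
  queries :: "nat set list"
  digits_read :: nat

text \<open>A configuration consists of the instructions still to be executed and the current state.\<close>

type_synonym config = "instr list \<times> state"

definition set_reg :: "reg \<Rightarrow> nat \<Rightarrow> state \<Rightarrow> state" where
  "set_reg r a s = s\<lparr>regs := (regs s)(r := a)\<rparr>"

definition binary_digit :: "real \<Rightarrow> nat \<Rightarrow> nat" where
  "binary_digit q i = nat (\<lfloor>q * 2 ^ Suc i\<rfloor> mod 2)"

text \<open>
  In \<open>step q n ans\<close>, \<open>ans u v\<close> is the reply for the pair \<open>{u, v}\<close>; the sign \<open>+1\<close> is stored as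
  \<open>1\<close> and the sign \<open>-1\<close> as \<open>0\<close>. A query that does not name two distinct items is not a query of
  the model: it yields \<open>0\<close> and is not recorded.
\<close>

fun step :: "real \<Rightarrow> nat \<Rightarrow> (nat \<Rightarrow> nat \<Rightarrow> bool) \<Rightarrow> config \<Rightarrow> config pmf" where
  "step q n ans ([], s) = return_pmf ([], s)"
| "step q n ans (Put r a # is, s) = return_pmf (is, set_reg r a s)"
| "step q n ans (Add r x y # is, s) = return_pmf (is, set_reg r (regs s x + regs s y) s)"
| "step q n ans (Sub r x y # is, s) = return_pmf (is, set_reg r (regs s x - regs s y) s)"
| "step q n ans (Load r x # is, s) = return_pmf (is, set_reg r (heap s (regs s x)) s)"
| "step q n ans (Store x r # is, s) =
     return_pmf (is, s\<lparr>heap := (heap s)(regs s x := regs s r)\<rparr>)"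
| "step q n ans (Query r x y # is, s) =
     (let u = regs s x; v = regs s y in
      return_pmf (is,
        if u < n \<and> v < n \<and> u \<noteq> v
        then set_reg r (of_bool (ans u v)) (s\<lparr>queries := {u, v} # queries s\<rparr>)
        else set_reg r 0 s))"
| "step q n ans (Coin r # is, s) =
     map_pmf (\<lambda>b. (is, set_reg r (of_bool b) s)) (bernoulli_pmf (1 / 2))"
| "step q n ans (Digit r # is, s) =
     return_pmf (is,
       set_reg r (binary_digit q (digits_read s)) (s\<lparr>digits_read := Suc (digits_read s)\<rparr>))"
| "step q n ans (Branch r as bs # is, s) =
     return_pmf ((if regs s r \<noteq> 0 then as else bs) @ is, s)"
| "step q n ans (Loop r as # is, s) =
     return_pmf (if regs s r \<noteq> 0 then as @ Loop r as # is else is, s)"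

fun steps :: "real \<Rightarrow> nat \<Rightarrow> (nat \<Rightarrow> nat \<Rightarrow> bool) \<Rightarrow> nat \<Rightarrow> config \<Rightarrow> config pmf" where
  "steps q n ans 0 k = return_pmf k"
| "steps q n ans (Suc t) k = bind_pmf (step q n ans k) (steps q n ans t)"

text \<open>The number of items is passed in register \<open>0\<close>.\<close>

definition init_state :: "nat \<Rightarrow> state" where
  "init_state n =
     \<lparr>regs = (\<lambda>_. 0)(0 := n), heap = (\<lambda>_. 0), queries = [], digits_read = 0\<rparr>"

definition halted :: "config \<Rightarrow> bool" where
  "halted k \<longleftrightarrow> fst k = []"

text \<open>The distribution of the configuration reached from the program \<open>P\<close> within \<open>t\<close> steps.\<close>

definition execution ::
  "instr list \<Rightarrow> real \<Rightarrow> nat \<Rightarrow> (nat \<Rightarrow> color) \<Rightarrow> nat \<Rightarrow> config pmf" where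
  "execution P q n f t =
     bind_pmf (noise q n) (\<lambda>w. steps q n (reply f w) t (P, init_state n))"

text \<open>
  The output is read off the heap: cell \<open>v\<close> holds a label of item \<open>v\<close>, and items are declared to
  be in the same cluster iff their labels agree. The names of the labels are irrelevant.
\<close>

definition recovers :: "nat \<Rightarrow> (nat \<Rightarrow> color) \<Rightarrow> config \<Rightarrow> bool" where
  "recovers n f k \<longleftrightarrow>
     (\<forall>u<n. \<forall>v<n. heap (snd k) u = heap (snd k) v \<longleftrightarrow> f u = f v)"

definition num_queries :: "config \<Rightarrow> nat" where
  "num_queries k = length (queries (snd k))"

text \<open>
  \<open>poly_time P q t\<close>: on every instance of size \<open>n\<close> and for all outcomes of noise and coins,
  the program \<open>P\<close> halts within \<open>t n\<close> steps, and \<open>t\<close> is polynomially bounded.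
\<close>

definition poly_time :: "instr list \<Rightarrow> real \<Rightarrow> (nat \<Rightarrow> nat) \<Rightarrow> bool" where
  "poly_time P q t \<longleftrightarrow>
     (\<exists>p :: nat poly. \<forall>n. t n \<le> poly p n) \<and>
     (\<forall>n f. \<forall>k \<in> set_pmf (execution P q n f (t n)). halted k)"

text \<open>
  The quantification over all sequences of instances and runs (one for each \<open>n\<close>) makes the
  asymptotic statements below uniform in the unknown colouring and in all random choices.
\<close>

definition query_complexity :: "instr list \<Rightarrow> real \<Rightarrow> (nat \<Rightarrow> nat) \<Rightarrow> (nat \<Rightarrow> real) \<Rightarrow> bool" where
  "query_complexity P q t g \<longleftrightarrow>
     (\<forall>f k. (\<forall>n. k n \<in> set_pmf (execution P q n (f n) (t n))) \<longrightarrow>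
        (\<lambda>n. real (num_queries (k n))) \<in> \<Theta>(g))"

definition recovers_whp :: "instr list \<Rightarrow> real \<Rightarrow> (nat \<Rightarrow> nat) \<Rightarrow> bool" where
  "recovers_whp P q t \<longleftrightarrow>
     (\<forall>f. (\<lambda>n. measure_pmf.prob (execution P q n (f n) (t n)) {k. recovers n (f n) k})
        \<longlonglongrightarrow> 1)"

end

theory Submission
  imports Defs "HOL-Real_Asymp.Real_Asymp" "HOL-Analysis.Harmonic_Numbers"
begin

text \<open>
  Item \<open>v\<close> is compared with item \<open>0\<close> through \<open>m\<close> common neighbours: the replies for \<open>{0, w}\<close> and
  \<open>{w, v}\<close> agree iff \<open>f 0 = f v\<close>, unless exactly one of them is wrong, which has probability
  \<open>p = 2 q (1 - q) < 1/2\<close> and is independent for different \<open>w\<close>. By a Chernoff bound the majority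
  over \<open>w\<close> is wrong with probability exponentially small in \<open>m\<close>, so a union bound over \<open>v\<close> succeeds
  as soon as \<open>m\<close> exceeds a large multiple of \<open>ln n\<close>. Between \<open>m n\<close> and \<open>2 m n\<close> queries are made.

  It remains to compute on the machine, up to a constant factor, the number
  \<open>ln n * d powr (- (ln n / ln (ln n)))\<close> with \<open>d = 1 - 2 q\<close>, which serves as \<open>m\<close>. The average of
  \<open>n div i\<close> over \<open>i \<le> n\<close> is \<open>ln n + O(1)\<close>; if \<open>b\<close> is such an approximation, the least \<open>k\<close> with
  \<open>n \<le> b ^ k\<close> is \<open>ln n / ln (ln n) + O(1)\<close>, because \<open>ln b\<close> differs from \<open>ln (ln n)\<close> only by
  \<open>O(1 / ln n)\<close>. Finally \<open>d ^ k\<close> is evaluated in fixed-point arithmetic with \<open>\<lceil>log\<^sub>2 n\<rceil>\<close> binary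
  digits of \<open>q\<close>; as \<open>d ^ k\<close> is \<open>n\<close> to the power \<open>- o(1)\<close>, the rounding errors are negligible.
\<close>

section \<open>Time-indexed program logic\<close>

text \<open>
  Without \<open>Coin\<close> the machine is deterministic. The number \<open>k\<close> is a clock: \<open>Q\<close> relates the final state
  to the time at which it is reached.
\<close>

definition wp :: "real \<Rightarrow> nat \<Rightarrow> (nat \<Rightarrow> nat \<Rightarrow> bool) \<Rightarrow> instr list \<Rightarrow> (state \<Rightarrow> nat \<Rightarrow> bool) \<Rightarrow> state \<Rightarrow> nat \<Rightarrow> bool" where
  "wp q n ans is Q s k \<longleftrightarrow>
     (\<exists>t s'. (\<forall>rest. steps q n ans t (is @ rest, s) = return_pmf (rest, s')) \<and> Q s' (k + t))"

lemma steps_add: "steps q n ans (t + t') k = bind_pmf (steps q n ans t k) (steps q n ans t')"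
  by (induction t arbitrary: k) (simp_all add: bind_return_pmf bind_assoc_pmf fun_eq_iff cong: bind_pmf_cong)

lemma steps_halted: "steps q n ans t ([], s) = return_pmf ([], s)"
  by (induction t) (simp_all add: bind_return_pmf)

text \<open>An equivalence, so that it yields rewrite rules for symbolic execution.
  \<open>as\<close> is the code that replaces the instruction: empty for plain instructions,
  nontrivial for \<open>Branch\<close> and \<open>Loop\<close>.\<close>

lemma wp_step:
  assumes "\<And>rest. step q n ans (i # is @ rest, s) = return_pmf (as @ is @ rest, s1)"
  shows "wp q n ans (i # is) Q s k \<longleftrightarrow> wp q n ans (as @ is) Q s1 (Suc k)"
proof
  assume "wp q n ans (i # is) Q s k"
  then obtain t s' where t: "\<And>rest. steps q n ans t ((i # is) @ rest, s) = return_pmf (rest, s')"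
    and Q: "Q s' (k + t)" unfolding wp_def by blast
  \<comment> \<open>With no step taken, the program would still stand in front of
    \<open>rest\<close>.\<close>
  have "t \<noteq> 0"
  proof
    assume "t = 0"
    with t[of "[]"] show False by (simp add: return_pmf_inj)
  qed
  then obtain u where u: "t = Suc u" by (cases t) auto
  show "wp q n ans (as @ is) Q s1 (Suc k)"
    unfolding wp_def using t Q
    by (intro exI[of _ u] exI[of _ s']) (simp add: u assms bind_return_pmf)
next
  assume "wp q n ans (as @ is) Q s1 (Suc k)"
  then obtain t s' where t: "\<And>rest. steps q n ans t ((as @ is) @ rest, s1) = return_pmf (rest, s')"
    and Q: "Q s' (Suc k + t)" unfolding wp_def by blast
  show "wp q n ans (i # is) Q s k"
    unfolding wp_def using t Q
    by (intro exI[of _ "Suc t"] exI[of _ s']) (simp add: assms bind_return_pmf)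
qed

lemma wp_Nil: "Q s k \<Longrightarrow> wp q n ans [] Q s k"
  unfolding wp_def by (intro exI[of _ 0] exI[of _ s]) simp

lemma wp_Nil_iff: "wp q n ans [] Q s k \<longleftrightarrow> Q s k"
proof
  assume "wp q n ans [] Q s k"
  then obtain t s' where "\<And>rest. steps q n ans t (rest, s) = return_pmf (rest, s')" "Q s' (k + t)"
    unfolding wp_def by auto
  note * = this
  have "t = 0"
  proof (cases t)
    case (Suc u)
    \<comment> \<open>A positive number of steps would consume a nonempty continuation.\<close>
    with *(1)[of "[Put 0 0]"] show ?thesis
      by (simp add: bind_return_pmf steps_halted return_pmf_inj)
  qed
  with *(1)[of "[]"] *(2) show "Q s k" by (simp add: return_pmf_inj)
qed (rule wp_Nil)

lemma wp_append:
  assumes "wp q n ans as (wp q n ans bs Q) s k"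
  shows "wp q n ans (as @ bs) Q s k"
proof -
  obtain t s1 where 1: "\<And>rest. steps q n ans t (as @ rest, s) = return_pmf (rest, s1)"
    "wp q n ans bs Q s1 (k + t)" using assms unfolding wp_def[of q n ans as] by blast
  obtain t' s' where 2: "\<And>rest. steps q n ans t' (bs @ rest, s1) = return_pmf (rest, s')"
    "Q s' (k + t + t')" using 1(2) unfolding wp_def by blast
  show ?thesis unfolding wp_def
    by (intro exI[of _ "t + t'"] exI[of _ s']) (use 1 2 in \<open>simp add: steps_add bind_return_pmf add.assoc\<close>)
qed

lemma wp_mono:
  assumes "wp q n ans is Q s k" "\<And>s k. Q s k \<Longrightarrow> Q' s k"
  shows "wp q n ans is Q' s k"
  using assms unfolding wp_def by blast

lemma wp_simps:
  "wp q n ans (Put r a # is) Q s k = wp q n ans is Q (set_reg r a s) (Suc k)"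
  "wp q n ans (Add r x y # is) Q s k = wp q n ans is Q (set_reg r (regs s x + regs s y) s) (Suc k)"
  "wp q n ans (Sub r x y # is) Q s k = wp q n ans is Q (set_reg r (regs s x - regs s y) s) (Suc k)"
  "wp q n ans (Store x r # is) Q s k =
     wp q n ans is Q (s\<lparr>heap := (heap s)(regs s x := regs s r)\<rparr>) (Suc k)"
  "wp q n ans (Query r x y # is) Q s k =
     wp q n ans is Q
       (let u = regs s x; v = regs s y; valid = (u < n \<and> v < n \<and> u \<noteq> v) in
        set_reg r (of_bool (valid \<and> ans u v))
          (s\<lparr>queries := (if valid then [{u, v}] else []) @ queries s\<rparr>)) (Suc k)"
  "wp q n ans (Digit r # is) Q s k =
     wp q n ans is Q (set_reg r (binary_digit q (digits_read s))
       (s\<lparr>digits_read := Suc (digits_read s)\<rparr>)) (Suc k)"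
  "wp q n ans (Branch r as bs # is) Q s k =
     wp q n ans ((if regs s r \<noteq> 0 then as else bs) @ is) Q s (Suc k)"
  by (subst wp_step[where as = "[]"]; simp add: Let_def set_reg_def; fail)+
    (subst wp_step[where as = "if regs s r \<noteq> 0 then as else bs" and ?s1.0 = s]; simp)

lemma wp_Loop_unfold:
  "wp q n ans (Loop r as # is) Q s k =
     wp q n ans (if regs s r \<noteq> 0 then as @ Loop r as # is else is) Q s (Suc k)"
  by (cases "regs s r = 0") (subst wp_step[where as = "if regs s r \<noteq> 0 then as @ [Loop r as] else []"]; simp)+

text \<open>The number \<open>l\<close> of iterations is fixed beforehand and indexes the invariant,
  so termination and running time come from one induction on \<open>l - i\<close>. Each
  \<open>Suc k\<close> pays for a loop test, including the failing one.\<close>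

lemma wp_Loop:
  assumes body: "\<And>i s k. i < l \<Longrightarrow> I i s k \<Longrightarrow> regs s r \<noteq> 0 \<and> wp q n ans as (I (Suc i)) s (Suc k)"
    and exit: "\<And>s k. I l s k \<Longrightarrow> regs s r = 0 \<and> Q s (Suc k)"
    and init: "I 0 s k"
  shows "wp q n ans [Loop r as] Q s k"
proof -
  have "wp q n ans [Loop r as] Q s k" if "I i s k" "i \<le> l" for i s k
    using that
  proof (induction "l - i" arbitrary: i s k)
    case 0
    then show ?case using exit by (auto simp: wp_Loop_unfold intro!: wp_Nil)
  next
    case (Suc j)
    then have "i < l" by simp
    from body[OF this Suc.prems(1)]
    have 1: "regs s r \<noteq> 0" and 2: "wp q n ans as (I (Suc i)) s (Suc k)" by auto
    have "wp q n ans (as @ [Loop r as]) Q s (Suc k)"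
    proof (rule wp_append, rule wp_mono[OF 2])
      fix s k assume "I (Suc i) s k"
      then show "wp q n ans [Loop r as] Q s k"
        using Suc.hyps(1)[of "Suc i" s k] Suc.hyps(2) \<open>i < l\<close> by simp
    qed
    then show ?case using 1 by (simp add: wp_Loop_unfold)
  qed
  from this[OF init] show ?thesis by simp
qed

text \<open>
  Register \<open>1\<close> holds the constant \<open>1\<close>, register \<open>3\<close> is never written and holds \<open>0\<close>, and
  register \<open>2\<close> is the loop counter of multiplication and division.
\<close>

definition mul_code :: "reg \<Rightarrow> reg \<Rightarrow> reg \<Rightarrow> instr list" where
  "mul_code z x y = [Add 2 x 3, Put z 0, Loop 2 [Add z z y, Sub 2 2 1]]"

text \<open>After \<open>i\<close> iterations the counter is \<open>x + 1 - (i + 1) * y\<close>,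
  truncated at \<open>0\<close>, which is nonzero iff \<open>(i + 1) * y \<le> x\<close>; hence the
  iterations count the quotient.\<close>

definition div_code :: "reg \<Rightarrow> reg \<Rightarrow> reg \<Rightarrow> instr list" where
  "div_code z x y = [Add 2 x 1, Sub 2 2 y, Put z 0, Loop 2 [Add z z 1, Sub 2 2 y]]"

lemma wp_mul_code:
  assumes "regs s 1 = 1" "regs s 3 = 0" "z \<notin> {1, 2, 3, y}" "y \<noteq> 2"
    and "Q (s\<lparr>regs := (regs s)(2 := 0, z := regs s x * regs s y)\<rparr>) (k + 3 * regs s x + 3)"
  shows "wp q n ans (mul_code z x y) Q s k"
proof -
  let ?I = "\<lambda>i s' k'. s' = s\<lparr>regs := (regs s)(2 := regs s x - i, z := i * regs s y)\<rparr> \<and> k' = k + 2 + 3 * i"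
  show ?thesis unfolding mul_code_def using assms
    apply (simp add: wp_simps set_reg_def)
    apply (rule wp_Loop[where I = ?I and l = "regs s x"])
      apply (auto simp: wp_simps set_reg_def fun_eq_iff algebra_simps numeral_3_eq_3 intro!: wp_Nil)
    done
qed

lemma wp_div_code:
  assumes "regs s 1 = 1" "z \<notin> {1, 2, y}" "y \<noteq> 2" "regs s y > 0"
    and "Q (s\<lparr>regs := (regs s)(2 := 0, z := regs s x div regs s y)\<rparr>) (k + 3 * (regs s x div regs s y) + 4)"
  shows "wp q n ans (div_code z x y) Q s k"
proof -
  let ?x = "regs s x" and ?y = "regs s y"
  have 1: "i < ?x div ?y \<Longrightarrow> Suc ?x - ?y - i * ?y > 0" for i
    using assms(4) less_eq_div_iff_mult_less_eq[of ?y "Suc i" ?x] by (simp add: Suc_le_eq)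
  have 2: "Suc ?x - ?y - (?x div ?y) * ?y = 0"
    using assms(4) less_eq_div_iff_mult_less_eq[of ?y "Suc (?x div ?y)" ?x] by simp
  let ?I = "\<lambda>i s' k'. s' = s\<lparr>regs := (regs s)(2 := Suc ?x - ?y - i * ?y, z := i)\<rparr> \<and> k' = k + 3 + 3 * i"
  show ?thesis unfolding div_code_def using assms
    apply (simp add: wp_simps set_reg_def)
    apply (rule wp_Loop[where I = ?I and l = "?x div ?y"])
    subgoal for i using 1[of i] by (auto simp: wp_simps set_reg_def fun_eq_iff intro!: wp_Nil)
    subgoal using 2 by (auto simp: fun_eq_iff eval_nat_numeral)
    subgoal by (simp add: fun_eq_iff)
    done
qed

section \<open>The sample size\<close>

text \<open>For \<open>b \<ge> 2\<close> and \<open>n \<ge> 1\<close>, the logarithm of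
  \<open>n\<close> to base \<open>b\<close> rounded up, in the form counted by a loop that
  multiplies by \<open>b\<close> until \<open>n\<close> is reached.\<close>

definition clog :: "nat \<Rightarrow> nat \<Rightarrow> nat" where
  "clog b n = (LEAST k. n \<le> b ^ k)"

lemma le_power_clog:
  assumes "b \<ge> 2" shows "n \<le> b ^ clog b n"
proof -
  have "n \<le> 2 ^ n" by (simp add: less_imp_le)
  also have "\<dots> \<le> b ^ n" using assms by (rule power_mono) simp
  finally show ?thesis unfolding clog_def by (rule LeastI)
qed

lemma power_less_clog: "i < clog b n \<Longrightarrow> b ^ i < n"
  unfolding clog_def using not_less_Least by fastforce

lemma clog_le: "b \<ge> 2 \<Longrightarrow> clog b n \<le> n"
  unfolding clog_def
  by (rule Least_le) (meson less_exp order.trans less_imp_le power_mono zero_le)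

text \<open>The inner floors on average and the outer floor lose at most \<open>1\<close> each; the
  summand \<open>2\<close> makes up for both and makes the estimate a suitable base for
  \<open>clog\<close>.\<close>

definition log_est :: "nat \<Rightarrow> nat" where
  "log_est n = (\<Sum>i=1..n. n div i) div n + 2"

lemma log_est_ge_2: "log_est n \<ge> 2"
  by (simp add: log_est_def)

lemma log_est_le: "log_est n \<le> n + 2"
proof -
  have "(\<Sum>i=1..n. n div i) \<le> (\<Sum>i=1..n. n)"
    by (intro sum_mono div_le_dividend)
  then have "(\<Sum>i=1..n. n div i) div n \<le> (n * n) div n"
    by (intro div_le_mono) simp
  also have "\<dots> \<le> n" by simp
  finally show ?thesis by (simp add: log_est_def)
qed

text \<open>A power of two, so that \<open>\<lfloor>q * scale n\<rfloor>\<close> is spelled out by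
  leading binary digits of \<open>q\<close>; of order \<open>n\<close>, so that arithmetic by
  repeated addition and subtraction stays polynomial.\<close>

definition scale :: "nat \<Rightarrow> nat" where
  "scale n = 2 ^ clog 2 n"

lemma scale_ge: "scale n \<ge> n"
  by (simp add: scale_def le_power_clog)

lemma scale_pos: "scale n > 0"
  by (simp add: scale_def)

lemma scale_le:
  assumes "n > 0" shows "scale n \<le> 2 * n"
proof (cases "clog 2 n")
  case 0
  then show ?thesis using assms by (simp add: scale_def)
next
  case (Suc k)
  then show ?thesis using power_less_clog[of k 2 n] by (simp add: scale_def)
qed

text \<open>Fixed-point approximations with denominator \<open>scale n\<close>: \<open>bias\<close> of \<open>1 - 2 * q\<close>, \<open>damped\<close> of its powers.\<close>

definition bias :: "real \<Rightarrow> nat \<Rightarrow> nat" where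
  "bias q n = scale n - 2 * nat \<lfloor>q * scale n\<rfloor>"

primrec damped :: "real \<Rightarrow> nat \<Rightarrow> nat \<Rightarrow> nat" where
  "damped q n 0 = scale n"
| "damped q n (Suc i) = damped q n i * bias q n div scale n"

lemma damped_le: "damped q n i \<le> scale n"
proof (induction i)
  case (Suc i)
  have "damped q n i * bias q n div scale n \<le> scale n * scale n div scale n"
    by (intro div_le_mono mult_le_mono Suc) (simp add: bias_def)
  then show ?case by simp
qed simp

text \<open>With \<open>k = clog (log_est n) n\<close>, the quotient of \<open>scale n\<close> by
  \<open>damped q n k\<close> stands for \<open>1 - 2 * q\<close> to the power \<open>-k\<close>.
  The added \<open>1\<close> keeps the divisor positive even if rounding has brought
  \<open>damped\<close> down to \<open>0\<close>.\<close>

definition sample_size :: "real \<Rightarrow> nat \<Rightarrow> nat" where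
  "sample_size q n =
     log_est n * scale n div (damped q n (clog (log_est n) n) + 1)"

lemma sample_size_le:
  assumes "n > 0" shows "sample_size q n \<le> (n + 2) * (2 * n)"
proof -
  have "sample_size q n \<le> log_est n * scale n"
    by (simp add: sample_size_def)
  also have "\<dots> \<le> (n + 2) * (2 * n)"
    by (intro mult_le_mono log_est_le scale_le assms)
  finally show ?thesis .
qed

section \<open>The program\<close>

lemma floor_binary_digit:
  assumes "q \<ge> 0"
  shows "nat \<lfloor>q * 2 ^ Suc i\<rfloor> = 2 * nat \<lfloor>q * 2 ^ i\<rfloor> + binary_digit q i"
proof -
  have "\<lfloor>q * 2 ^ Suc i\<rfloor> div 2 = \<lfloor>q * 2 ^ i\<rfloor>"
    using floor_divide_real_eq_div[of 2 "q * 2 ^ Suc i"] by simp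
  moreover have "\<lfloor>q * 2 ^ Suc i\<rfloor> \<ge> 0" "\<lfloor>q * 2 ^ i\<rfloor> \<ge> 0" using assms by simp_all
  ultimately show ?thesis unfolding binary_digit_def
    by (metis (no_types, opaque_lifting) nat_add_distrib nat_mult_distrib mult_div_mod_eq
        zero_le_numeral nat_numeral mult_nonneg_nonneg pos_mod_sign zero_less_numeral)
qed

lemma greaterThanAtMost_diff_Suc:
  fixes m i :: nat
  assumes "i < m" shows "{m - Suc i<..m} = insert (m - i) {m - i<..m}"
  using assms by auto

text \<open>Results pass between stages in fixed registers: \<open>7\<close> for
  \<open>log_est n\<close>, \<open>8\<close> for \<open>scale n\<close>, \<open>10\<close> for
  \<open>bias q n\<close>, \<open>12\<close> for the damped power, \<open>13\<close> for the sample
  size. Register \<open>4\<close> guards loops and \<open>5\<close> is scratch.\<close>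

definition log_code :: "instr list" where
  "log_code =
     [Put 6 0, Add 4 0 3, Loop 4 (div_code 5 0 4 @ [Add 6 6 5, Sub 4 4 1])] @
     div_code 7 6 0 @ [Add 7 7 1, Add 7 7 1]"

text \<open>The truncated guard \<open>n - 2 ^ i\<close> first vanishes at
  \<open>i = clog 2 n\<close>, so exactly that many digits are read. \<open>damp_code\<close> stops
  by the same device with powers of \<open>log_est n\<close>.\<close>

definition bias_code :: "instr list" where
  "bias_code =
     [Put 8 1, Put 9 0, Sub 4 0 8,
      Loop 4 [Digit 5, Add 9 9 9, Add 9 9 5, Add 8 8 8, Sub 4 0 8],
      Sub 10 8 9, Sub 10 10 9]"

definition damp_code :: "instr list" where
  "damp_code =
     [Put 11 1, Add 12 8 3, Sub 4 0 11,
      Loop 4 (mul_code 5 11 7 @ [Add 11 5 3] @ mul_code 5 12 10 @ div_code 12 5 8 @ [Sub 4 0 11])]"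

definition sample_code :: "instr list" where
  "sample_code = mul_code 5 7 8 @ [Add 12 12 1] @ div_code 13 5 12"

text \<open>The two truncated differences of the reply bits add up to their distance, which is
  \<open>1\<close> iff they disagree. Register \<open>3\<close> serves as the name of item
  \<open>0\<close>.\<close>

definition vote_code :: "instr list" where
  "vote_code =
     [Put 18 0, Add 15 13 3,
      Loop 15 [Query 16 3 15, Query 17 15 14, Sub 5 16 17, Sub 19 17 16, Add 18 18 5, Add 18 18 19,
        Sub 15 15 1]]"

text \<open>For \<open>d\<close> disagreements among \<open>m\<close> samples,
  \<open>m - d - d\<close> is nonzero iff \<open>2 * d < m\<close>; otherwise register
  \<open>5\<close> already holds the label \<open>0\<close>.\<close>

definition label_code :: "instr list" where
  "label_code =
     [Add 14 0 3,
      Loop 14 ([Sub 14 14 1] @ vote_code @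
        [Sub 5 13 18, Sub 5 5 18, Branch 5 [Put 5 1] [], Store 14 5])]"

text \<open>The branch protects the case \<open>n = 0\<close>, in which the division by register
  \<open>0\<close> in \<open>log_code\<close> would loop forever.\<close>

definition cluster_code :: "instr list" where
  "cluster_code =
     [Put 1 1, Branch 0 (log_code @ bias_code @ damp_code @ sample_code @ label_code) []]"

definition base :: "nat \<Rightarrow> state \<Rightarrow> bool" where
  "base n s \<longleftrightarrow> regs s 0 = n \<and> regs s (Suc 0) = 1 \<and> regs s 3 = 0 \<and> queries s = []"

section \<open>Correctness and cost of the stages\<close>

lemma wp_log_code:
  assumes "base n s" "n > 0"
  shows "wp q n ans log_code
    (\<lambda>s' k'. base n s' \<and> digits_read s' = digits_read s \<and> regs s' 7 = log_est n \<and> k' \<le> k + 3 * n ^ 2 + 10 * n + 9) s k"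
proof -
  let ?Q = "\<lambda>s' k'. base n s' \<and> digits_read s' = digits_read s \<and> regs s' 7 = log_est n \<and> k' \<le> k + 3 * n ^ 2 + 10 * n + 9"
  \<comment> \<open>Divisors run from \<open>n\<close> downwards. An iteration costs the test, at
    most \<open>3 * n + 4\<close> steps of division and two instructions.\<close>
  let ?I = "\<lambda>i s' k'. base n s' \<and> digits_read s' = digits_read s \<and> regs s' 4 = n - i \<and>
    regs s' 6 = (\<Sum>j\<in>{n - i<..n}. n div j) \<and> k' \<le> k + 2 + i * (3 * n + 7)"
  have est: "(\<Sum>j\<in>{0<..n}. n div j) div n = log_est n - 2"
    by (simp add: log_est_def atLeastSucAtMost_greaterThanAtMost)
  have "wp q n ans (div_code 7 6 0 @ [Add 7 7 1, Add 7 7 1]) ?Q s' k'"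
    if "base n s'" "digits_read s' = digits_read s" "regs s' 6 = (\<Sum>j\<in>{0<..n}. n div j)" "k' \<le> k + 3 + n * (3 * n + 7)" for s' k'
    apply (rule wp_append, rule wp_div_code)
    using that assms(2) est log_est_ge_2[of n] log_est_le[of n]
    by (auto simp: wp_simps set_reg_def base_def algebra_simps power2_eq_square intro!: wp_Nil)
  note tail = this
  have "wp q n ans ([Put 6 0, Add 4 0 3] @ [Loop 4 (div_code 5 0 4 @ [Add 6 6 5, Sub 4 4 1])])
     (wp q n ans (div_code 7 6 0 @ [Add 7 7 1, Add 7 7 1]) ?Q) s k"
    using assms
    apply (simp add: wp_simps set_reg_def)
    apply (rule wp_Loop[where I = ?I and l = n])
    subgoal for i s' k'
      apply (intro conjI)
       apply simp
      apply (rule wp_append, rule wp_div_code)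
          apply (auto simp: base_def)
      apply (simp add: wp_simps set_reg_def)
      apply (rule wp_Nil)
      using div_le_dividend[of n "n - i"]
      apply (auto simp: greaterThanAtMost_diff_Suc algebra_simps simp del: div_le_dividend)
      done
    subgoal using tail by simp
    subgoal by (simp add: base_def)
    done
  from wp_append[OF this] show ?thesis by (simp add: log_code_def)
qed

lemma wp_bias_code:
  assumes "base n s" "digits_read s = 0" "regs s 7 = b" "q \<ge> 0" "q < 1"
  shows "wp q n ans bias_code
    (\<lambda>s' k'. base n s' \<and> regs s' 7 = b \<and> regs s' 8 = scale n \<and> regs s' 10 = bias q n \<and>
      k' \<le> k + 6 * n + 6) s k"
proof -
  let ?Q = "\<lambda>s' k'. base n s' \<and> regs s' 7 = b \<and> regs s' 8 = scale n \<and> regs s' 10 = bias q n \<and>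
      k' \<le> k + 6 * n + 6"
  let ?I = "\<lambda>i s' k'. base n s' \<and> digits_read s' = i \<and> regs s' 7 = b \<and>
    regs s' 4 = n - 2 ^ i \<and> regs s' 8 = 2 ^ i \<and> regs s' 9 = nat \<lfloor>q * 2 ^ i\<rfloor> \<and> k' = k + 3 + 6 * i"
  have fl0: "\<lfloor>q\<rfloor> = 0" using assms by (simp add: floor_eq_iff)
  have "wp q n ans ([Put 8 1, Put 9 0, Sub 4 0 8] @
      [Loop 4 [Digit 5, Add 9 9 9, Add 9 9 5, Add 8 8 8, Sub 4 0 8]])
     (wp q n ans [Sub 10 8 9, Sub 10 10 9] ?Q) s k"
    using assms(1-3)
    apply (simp add: wp_simps set_reg_def)
    apply (rule wp_Loop[where I = ?I and l = "clog 2 n"])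
    subgoal for i s' k'
      using power_less_clog[of i 2 n] floor_binary_digit[OF assms(4), of i]
      by (auto simp: wp_simps set_reg_def base_def intro!: wp_Nil)
    subgoal
      using le_power_clog[of 2 n] clog_le[of 2 n]
      by (auto simp: wp_simps set_reg_def base_def bias_def scale_def intro!: wp_Nil)
    subgoal by (simp add: base_def fl0)
    done
  from wp_append[OF this] show ?thesis by (simp add: bias_code_def)
qed

lemma wp_damp_code:
  assumes "base n s" "regs s 7 = b" "regs s 8 = scale n" "regs s 10 = bias q n" "b \<ge> 2" "n > 0"
  shows "wp q n ans damp_code
    (\<lambda>s' k'. base n s' \<and> regs s' 7 = b \<and> regs s' 8 = scale n \<and>
      regs s' 12 = damped q n (clog b n) \<and> k' \<le> k + n * (13 + 15 * n) + 4) s k"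
proof -
  let ?Q = "\<lambda>s' k'. base n s' \<and> regs s' 7 = b \<and> regs s' 8 = scale n \<and>
      regs s' 12 = damped q n (clog b n) \<and> k' \<le> k + n * (13 + 15 * n) + 4"
  \<comment> \<open>The first product takes \<open>b ^ i < n\<close> rounds; the second product and
    the quotient take at most \<open>scale n \<le> 2 * n\<close> rounds each. At three steps per
    round this gives \<open>15 * n\<close>.\<close>
  let ?I = "\<lambda>i s' k'. base n s' \<and> regs s' 7 = b \<and> regs s' 8 = scale n \<and> regs s' 10 = bias q n \<and>
    regs s' 4 = n - b ^ i \<and> regs s' 11 = b ^ i \<and> regs s' 12 = damped q n i \<and>
    k' \<le> k + 3 + i * (13 + 15 * n)"
  have time: "clog b n * (13 + 15 * n) \<le> n * (13 + 15 * n)"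
    using clog_le[OF assms(5)] by (rule mult_le_mono1)
  have "wp q n ans ([Put 11 1, Add 12 8 3, Sub 4 0 11] @
      [Loop 4 (mul_code 5 11 7 @ [Add 11 5 3] @ mul_code 5 12 10 @ div_code 12 5 8 @ [Sub 4 0 11])])
     ?Q s k"
    using assms
    apply (simp add: wp_simps set_reg_def)
    apply (rule wp_Loop[where I = ?I and l = "clog b n"])
    subgoal for i s' k'
      apply (intro conjI)
      subgoal using power_less_clog[of i b n] by simp
      apply (rule wp_append, rule wp_mul_code)
      subgoal by (simp add: base_def)
      subgoal by (simp add: base_def)
      subgoal by simp
      subgoal by simp
      apply (simp add: wp_simps set_reg_def)
      apply (rule wp_append, rule wp_mul_code)
      subgoal by (simp add: base_def)
      subgoal by (simp add: base_def)
      subgoal by simp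
      subgoal by simp
      apply simp
      apply (rule wp_append, rule wp_div_code)
      subgoal by (simp add: base_def)
      subgoal by simp
      subgoal by simp
      subgoal by (simp add: scale_pos)
      apply (simp add: wp_simps set_reg_def)
      apply (rule wp_Nil)
      using power_less_clog[of i b n] damped_le[of q n i] damped_le[of q n "Suc i"] scale_le[of n]
      by (simp add: base_def mult.commute[of b])
    subgoal for s' k'
      using le_power_clog[of b n] time by (intro conjI) (simp, simp, simp, simp, simp, linarith)
    subgoal by (simp add: base_def)
    done
  then show ?thesis by (simp add: damp_code_def)
qed

lemma wp_sample_code:
  assumes "base n s" "regs s 7 = log_est n" "regs s 8 = scale n"
    "regs s 12 = damped q n (clog (log_est n) n)" "n > 0"
  shows "wp q n ans sample_code
    (\<lambda>s' k'. base n s' \<and> regs s' 13 = sample_size q n \<and>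
      k' \<le> k + 6 * n * (n + 2) + 3 * n + 14) s k"
  using assms
  unfolding sample_code_def
  apply -
  apply (rule wp_append, rule wp_mul_code)
      apply (simp_all add: base_def wp_simps set_reg_def)
  apply (rule wp_div_code)
      apply (simp_all flip: Suc_eq_plus1)
  using log_est_le[of n] sample_size_le[of n q]
  apply (simp add: sample_size_def algebra_simps)
  done

text \<open>Invalid queries return \<open>0\<close>, which the guards in the next two definitions reflect.\<close>

definition disagreements :: "nat \<Rightarrow> (nat \<Rightarrow> nat \<Rightarrow> bool) \<Rightarrow> nat \<Rightarrow> nat set \<Rightarrow> nat" where
  "disagreements n ans v W =
     card {w \<in> W. (w \<in> {0<..<n} \<and> ans 0 w) \<noteq> (w < n \<and> w \<noteq> v \<and> ans w v)}"

definition vote_queries :: "nat \<Rightarrow> nat \<Rightarrow> nat set \<Rightarrow> nat" where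
  "vote_queries n v W = (\<Sum>w\<in>W. of_bool (w \<in> {0<..<n}) + of_bool (w < n \<and> w \<noteq> v))"

lemma disagreements_insert:
  assumes "finite W" "u \<notin> W"
  shows "disagreements n ans v (insert u W) =
    of_bool ((u \<in> {0<..<n} \<and> ans 0 u) \<noteq> (u < n \<and> u \<noteq> v \<and> ans u v)) + disagreements n ans v W"
proof -
  let ?D = "\<lambda>w. (w \<in> {0<..<n} \<and> ans 0 w) \<noteq> (w < n \<and> w \<noteq> v \<and> ans w v)"
  have "{w \<in> insert u W. ?D w} = (if ?D u then insert u {w \<in> W. ?D w} else {w \<in> W. ?D w})"
    by auto
  then show ?thesis using assms unfolding disagreements_def by simp
qed

lemma wp_vote_code:
  assumes "regs s 0 = n" "regs s (Suc 0) = 1" "regs s 3 = 0" "regs s 14 = v" "v < n"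
  shows "wp q n ans vote_code
    (\<lambda>s' k'. regs s' 0 = n \<and> regs s' (Suc 0) = 1 \<and> regs s' 3 = 0 \<and> regs s' 14 = v \<and>
      regs s' 13 = regs s 13 \<and> heap s' = heap s \<and>
      regs s' 18 = disagreements n ans v {1..regs s 13} \<and>
      length (queries s') = length (queries s) + vote_queries n v {1..regs s 13} \<and>
      k' = k + 8 * regs s 13 + 3) s k"
proof -
  let ?m = "regs s 13"
  let ?I = "\<lambda>i s' k'. regs s' 0 = n \<and> regs s' (Suc 0) = 1 \<and> regs s' 3 = 0 \<and> regs s' 14 = v \<and>
      regs s' 13 = regs s 13 \<and> heap s' = heap s \<and> regs s' 15 = ?m - i \<and>
      regs s' 18 = disagreements n ans v {?m - i<..?m} \<and>
      length (queries s') = length (queries s) + vote_queries n v {?m - i<..?m} \<and>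
      k' = k + 2 + 8 * i"
  show ?thesis
    using assms unfolding vote_code_def
    apply (simp add: wp_simps set_reg_def)
    apply (rule wp_Loop[where I = ?I and l = ?m])
    subgoal for i s' k'
      apply (intro conjI)
       apply simp
      apply (simp add: wp_simps set_reg_def Let_def wp_Nil_iff split del: if_split)
      apply (simp add: greaterThanAtMost_diff_Suc disagreements_insert vote_queries_def)
      done
    subgoal by (simp add: atLeastSucAtMost_greaterThanAtMost)
    subgoal by (simp add: disagreements_def vote_queries_def)
    done
qed

lemma wp_label_code:
  assumes "base n s" "regs s 13 = m"
  shows "wp q n ans label_code
    (\<lambda>s' k'. (\<forall>v<n. heap s' v = of_bool (2 * disagreements n ans v {1..m} < m)) \<and>
      length (queries s') = (\<Sum>v<n. vote_queries n v {1..m}) \<and>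
      k' \<le> k + n * (8 * m + 10) + 2) s k"
proof -
  \<comment> \<open>Besides the \<open>8 * m + 3\<close> steps of the vote, an item costs at most
    seven: the test, three subtractions, the branch, possibly \<open>Put\<close>, and the
    store.\<close>
  let ?I = "\<lambda>i s' k'. regs s' 0 = n \<and> regs s' (Suc 0) = 1 \<and> regs s' 3 = 0 \<and> regs s' 13 = m \<and>
      regs s' 14 = n - i \<and>
      (\<forall>v\<in>{n - i..<n}. heap s' v = of_bool (2 * disagreements n ans v {1..m} < m)) \<and>
      length (queries s') = (\<Sum>v\<in>{n - i..<n}. vote_queries n v {1..m}) \<and>
      k' \<le> k + 1 + i * (8 * m + 10)"
  have ins: "{n - Suc i..<n} = insert (n - Suc i) {n - i..<n}" if "i < n" for i
    using that by auto
  show ?thesis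
    using assms unfolding label_code_def
    apply (simp add: wp_simps set_reg_def)
    apply (rule wp_Loop[where I = ?I and l = n])
    subgoal for i s' k'
      apply (intro conjI)
      subgoal by simp
      apply (simp add: wp_simps set_reg_def)
      apply (rule wp_append, rule wp_mono, rule wp_vote_code[where n = n and v = "n - Suc i"])
      subgoal by simp
      subgoal by simp
      subgoal by simp
      subgoal by simp
      subgoal by simp
      subgoal for s'' k''
        apply (cases "2 * disagreements n ans (n - Suc i) {1..m} < m")
         apply (simp_all add: wp_simps set_reg_def)
         apply (simp_all add: wp_Nil_iff ins)
        done
      done
    subgoal by (simp add: lessThan_atLeast0)
    subgoal by (simp add: base_def)
    done
qed

text \<open>Votes dominate: \<open>n\<close> items with at most \<open>(n + 2) * (2 * n)\<close>
  samples each. This crude sample bound is used because halting is demanded for every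
  \<open>n\<close>, not only for large ones.\<close>

definition run_time :: "nat \<Rightarrow> nat" where
  "run_time n = 100 * (n + 1) ^ 3"

lemma wp_cluster_code:
  assumes "0 \<le> q" "q < 1"
  shows "wp q n ans cluster_code
    (\<lambda>s k. (\<forall>v<n. heap s v =
        of_bool (2 * disagreements n ans v {1..sample_size q n} < sample_size q n)) \<and>
      length (queries s) = (\<Sum>v<n. vote_queries n v {1..sample_size q n}) \<and>
      k \<le> run_time n) (init_state n) 0"
proof (cases "n = 0")
  case True
  then show ?thesis
    by (simp add: cluster_code_def wp_simps wp_Nil_iff set_reg_def init_state_def run_time_def)
next
  case False
  then have n: "n > 0" by simp
  have "n * (8 * sample_size q n + 10) \<le> n * (8 * ((n + 2) * (2 * n)) + 10)"
    by (intro mult_le_mono add_le_mono sample_size_le[OF n] order_refl)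
  also have "\<dots> = 16 * n ^ 3 + 32 * n ^ 2 + 10 * n"
    by (simp add: algebra_simps power2_eq_square power3_eq_cube)
  finally have label: "n * (8 * sample_size q n + 10) \<le> 16 * n ^ 3 + 32 * n ^ 2 + 10 * n" .
  have total: "run_time n = 100 * n ^ 3 + 300 * n ^ 2 + 300 * n + 100"
    by (simp add: run_time_def algebra_simps power2_eq_square power3_eq_cube)
  let ?Q = "\<lambda>s k. (\<forall>v<n. heap s v =
        of_bool (2 * disagreements n ans v {1..sample_size q n} < sample_size q n)) \<and>
      length (queries s) = (\<Sum>v<n. vote_queries n v {1..sample_size q n}) \<and>
      k \<le> run_time n"
  define s where "s = set_reg 1 1 (init_state n)"
  have s: "base n s" "digits_read s = 0"
    by (simp_all add: s_def base_def init_state_def set_reg_def)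
  have "wp q n ans (log_code @ bias_code @ damp_code @ sample_code @ label_code) ?Q s 2"
    using n
    apply -
    apply (rule wp_append, rule wp_mono[OF wp_log_code[where n = n]])
    subgoal by (rule s(1))
    subgoal by simp
    apply (rule wp_append, rule wp_mono[OF wp_bias_code[where n = n and b = "log_est n"]])
    subgoal by simp
    subgoal by (simp add: s(2))
    subgoal by simp
    subgoal by (rule assms(1))
    subgoal by (rule assms(2))
    apply (rule wp_append, rule wp_mono[OF wp_damp_code[where n = n and b = "log_est n"]])
    subgoal by simp
    subgoal by simp
    subgoal by simp
    subgoal by simp
    subgoal by (rule log_est_ge_2)
    subgoal by simp
    apply (rule wp_append, rule wp_mono[OF wp_sample_code[where n = n and q = q]])
    subgoal by simp
    subgoal by simp
    subgoal by simp
    subgoal by simp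
    subgoal by simp
    apply (rule wp_mono[OF wp_label_code[where n = n and m = "sample_size q n"]])
    subgoal by simp
    subgoal by simp
    subgoal for s1 k1 s2 k2 s3 k3 s4 k4 s5 k5
      using label by (simp add: total algebra_simps power2_eq_square)
    done
  moreover have "regs s 0 = n" using s(1) by (simp add: base_def)
  ultimately show ?thesis
    using n unfolding cluster_code_def wp_simps s_def[symmetric] by (simp add: numeral_2_eq_2)
qed

section \<open>From the program logic to executions\<close>

lemma steps_cluster_code:
  assumes "0 \<le> q" "q < 1"
  shows "\<exists>s. steps q n ans (run_time n) (cluster_code, init_state n) = return_pmf ([], s) \<and>
    (\<forall>v<n. heap s v = of_bool (2 * disagreements n ans v {1..sample_size q n} < sample_size q n)) \<and>
    length (queries s) = (\<Sum>v<n. vote_queries n v {1..sample_size q n})"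
proof -
  obtain t s where t: "\<And>rest. steps q n ans t (cluster_code @ rest, init_state n) = return_pmf (rest, s)"
    and s: "(\<forall>v<n. heap s v = of_bool (2 * disagreements n ans v {1..sample_size q n} < sample_size q n)) \<and>
      length (queries s) = (\<Sum>v<n. vote_queries n v {1..sample_size q n})" and "t \<le> run_time n"
    using wp_cluster_code[OF assms, of n ans] unfolding wp_def by auto
  \<comment> \<open>A halted configuration is a fixed point, so the run may be padded to the common
    length.\<close>
  have "steps q n ans (run_time n) (cluster_code, init_state n) =
      steps q n ans (t + (run_time n - t)) (cluster_code, init_state n)"
    using \<open>t \<le> run_time n\<close> by simp
  also have "\<dots> = return_pmf ([], s)"
    using t[of "[]"] by (simp only: steps_add bind_return_pmf steps_halted append_Nil2)
  finally show ?thesis using s by blast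
qed

text \<open>The program tosses no coins, so the final state is a function \<open>R\<close> of the
  noise alone, and the number of queries does not even depend on the noise.\<close>

lemma execution_cluster_code:
  assumes "0 \<le> q" "q < 1"
  obtains R where "execution cluster_code q n f (run_time n) = map_pmf (\<lambda>w. ([], R w)) (noise q n)"
    "\<And>w v. v < n \<Longrightarrow> heap (R w) v =
       of_bool (2 * disagreements n (reply f w) v {1..sample_size q n} < sample_size q n)"
    "\<And>w. length (queries (R w)) = (\<Sum>v<n. vote_queries n v {1..sample_size q n})"
proof -
  have "\<forall>w. \<exists>s. steps q n (reply f w) (run_time n) (cluster_code, init_state n) = return_pmf ([], s) \<and>
    (\<forall>v<n. heap s v = of_bool (2 * disagreements n (reply f w) v {1..sample_size q n} < sample_size q n)) \<and>
    length (queries s) = (\<Sum>v<n. vote_queries n v {1..sample_size q n})"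
    using steps_cluster_code[OF assms] by blast
  then obtain R where R: "\<And>w. steps q n (reply f w) (run_time n) (cluster_code, init_state n) = return_pmf ([], R w) \<and>
    (\<forall>v<n. heap (R w) v = of_bool (2 * disagreements n (reply f w) v {1..sample_size q n} < sample_size q n)) \<and>
    length (queries (R w)) = (\<Sum>v<n. vote_queries n v {1..sample_size q n})"
    by metis
  show ?thesis
  proof (rule that)
    show "execution cluster_code q n f (run_time n) = map_pmf (\<lambda>w. ([], R w)) (noise q n)"
      using R by (simp add: execution_def map_pmf_def)
  qed (use R in blast)+
qed

lemma poly_time_cluster_code:
  assumes "0 \<le> q" "q < 1"
  shows "poly_time cluster_code q run_time"
  unfolding poly_time_def
proof (intro conjI allI ballI)
  show "\<exists>p :: nat poly. \<forall>n. run_time n \<le> poly p n"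
    by (rule exI[of _ "[:100:] * [:1, 1:] ^ 3"]) (simp add: run_time_def add.commute)
next
  fix n f k assume k: "k \<in> set_pmf (execution cluster_code q n f (run_time n))"
  obtain R where "execution cluster_code q n f (run_time n) = map_pmf (\<lambda>w. ([], R w)) (noise q n)"
    using execution_cluster_code[OF assms] by metis
  with k show "halted k" by (auto simp: halted_def)
qed

text \<open>When all samples are items, \<open>{0, w}\<close> is always a legal pair and
  \<open>{w, v}\<close> fails only for \<open>w = v\<close>, so each sample costs one or two
  queries.\<close>

lemma num_queries_cluster_code:
  assumes "0 \<le> q" "q < 1" "sample_size q n < n"
    and "k \<in> set_pmf (execution cluster_code q n f (run_time n))"
  shows "num_queries k \<in> {sample_size q n * n..2 * sample_size q n * n}"
proof -
  let ?m = "sample_size q n"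
  obtain R where R: "execution cluster_code q n f (run_time n) = map_pmf (\<lambda>w. ([], R w)) (noise q n)"
    "\<And>w. length (queries (R w)) = (\<Sum>v<n. vote_queries n v {1..?m})"
    using execution_cluster_code[OF assms(1,2)] by metis
  have k: "num_queries k = (\<Sum>v<n. vote_queries n v {1..?m})"
    using assms(4) R by (auto simp: num_queries_def)
  have v: "vote_queries n v {1..?m} \<in> {?m..2 * ?m}" for v
  proof -
    have "(\<Sum>w=1..?m. 1) \<le> vote_queries n v {1..?m}" "vote_queries n v {1..?m} \<le> (\<Sum>w=1..?m. 2)"
      using assms(3) unfolding vote_queries_def by (intro sum_mono; auto)+
    then show ?thesis by simp
  qed
  have "(\<Sum>v<n. ?m) \<le> (\<Sum>v<n. vote_queries n v {1..?m})"
    "(\<Sum>v<n. vote_queries n v {1..?m}) \<le> (\<Sum>v<n. 2 * ?m)"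
    using v by (intro sum_mono; simp)+
  with k show ?thesis by (simp add: mult_ac)
qed

section \<open>Error probability\<close>

lemma finite_item_pairs: "finite (item_pairs n)"
proof -
  have "item_pairs n \<subseteq> (\<lambda>(u, v). {u, v}) ` ({..<n} \<times> {..<n})"
    unfolding item_pairs_def by auto
  then show ?thesis by (rule finite_subset) auto
qed

lemma doubleton_item_pairs: "u < n \<Longrightarrow> v < n \<Longrightarrow> u \<noteq> v \<Longrightarrow> {u, v} \<in> item_pairs n"
  unfolding item_pairs_def by blast

definition error :: "(nat set \<Rightarrow> bool) \<Rightarrow> nat \<Rightarrow> nat \<Rightarrow> bool" where
  "error w v x \<longleftrightarrow> w {0, x} \<noteq> w {x, v}"

lemma expectation_two_bernoulli:
  fixes h :: "'a \<Rightarrow> real"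
  assumes "0 \<le> q" "q \<le> 1"
  shows "measure_pmf.expectation
      (bind_pmf (bernoulli_pmf q) (\<lambda>a. bind_pmf (bernoulli_pmf q) (\<lambda>b. return_pmf (k a b)))) h =
    q ^ 2 * h (k True True) + q * (1 - q) * (h (k True False) + h (k False True)) +
    (1 - q) ^ 2 * h (k False False)"
proof -
  have inner: "measure_pmf.expectation (bind_pmf (bernoulli_pmf q) (\<lambda>b. return_pmf (k a b))) h =
      q * h (k a True) + (1 - q) * h (k a False)" for a
    using assms by (simp flip: map_pmf_def)
  have "finite (set_pmf (bind_pmf (bernoulli_pmf q) (\<lambda>b. return_pmf (k a b))))" for a
    by (simp flip: map_pmf_def)
  moreover have "set_pmf (bernoulli_pmf q) \<subseteq> {False, True}"
    by auto
  ultimately show ?thesis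
    by (subst pmf_expectation_bind[of UNIV])
      (use assms in \<open>simp_all add: UNIV_bool inner algebra_simps power2_eq_square\<close>)
qed

text \<open>Different \<open>x\<close> involve disjoint sets of pairs, because \<open>x\<close>
  avoids \<open>0\<close> and \<open>v\<close>. The errors are therefore independent and the mean of
  the product factorises.\<close>

lemma expectation_error:
  fixes W :: "nat set" and g :: "bool \<Rightarrow> real"
  assumes "0 \<le> q" "q \<le> 1" "0 < v" "v < n" "W \<subseteq> {1..<n} - {v}"
  shows "measure_pmf.expectation (noise q n) (\<lambda>w. \<Prod>x\<in>W. g (error w v x)) =
    ((1 - 2 * q * (1 - q)) * g False + 2 * q * (1 - q) * g True) ^ card W"
proof -
  let ?K = "\<lambda>x. {{0, x}, {x, v}}"
  have W: "x \<noteq> 0" "x < n" "x \<noteq> v" if "x \<in> W" for x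
    using assms(5) that by auto
  have sub: "?K x \<subseteq> item_pairs n" if "x \<in> W" for x
    using W[OF that] assms(3,4) by (auto intro!: doubleton_item_pairs)
  have disj: "disjoint_family_on ?K W"
    unfolding disjoint_family_on_def
  proof (intro ballI impI)
    fix x y assume "x \<in> W" "y \<in> W" "x \<noteq> y"
    then show "?K x \<inter> ?K y = {}"
      using W[of x] W[of y] assms(3) by (simp add: doubleton_eq_iff)
  qed
  have fin: "finite W" using assms(5) finite_subset by blast
  have "prob_space.indep_vars (measure_pmf (noise q n)) (\<lambda>_. count_space UNIV) (\<lambda>p w. w p) (item_pairs n)"
    using indep_vars_Pi_pmf[OF finite_item_pairs, of n False "\<lambda>_. bernoulli_pmf q"]
    by (simp add: noise_def)
  then have "prob_space.indep_vars (measure_pmf (noise q n)) (\<lambda>x. PiM (?K x) (\<lambda>_. count_space UNIV))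
      (\<lambda>x w. restrict (\<lambda>p. w p) (?K x)) W"
    by (rule prob_space.indep_vars_restrict[OF prob_space_measure_pmf _ sub disj])
  then have "prob_space.indep_vars (measure_pmf (noise q n)) (\<lambda>_. borel) (\<lambda>x w. g ((restrict w (?K x)) {0, x} \<noteq> (restrict w (?K x)) {x, v})) W"
    by (rule prob_space.indep_vars_compose2[OF prob_space_measure_pmf]) simp
  then have ind: "prob_space.indep_vars (measure_pmf (noise q n)) (\<lambda>_. borel) (\<lambda>x w. g (error w v x)) W"
    by (simp add: error_def)
  have one: "measure_pmf.expectation (noise q n) (\<lambda>w. g (error w v x)) =
      (1 - 2 * q * (1 - q)) * g False + 2 * q * (1 - q) * g True" if "x \<in> W" for x
  proof -
    have K: "?K x \<subseteq> item_pairs n" "{0, x} \<noteq> {x, v}"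
      using sub[OF that] W[OF that] assms(3) by (simp_all add: doubleton_eq_iff)
    \<comment> \<open>Only the noise bits of the two pairs in \<open>?K x\<close> matter, so their
      marginal distribution suffices.\<close>
    have 1: "measure_pmf.expectation (noise q n) (\<lambda>w. g (error w v x)) =
      measure_pmf.expectation (Pi_pmf (?K x) False (\<lambda>_. bernoulli_pmf q)) (\<lambda>w. g (error w v x))"
      unfolding noise_def Pi_pmf_subset[OF finite_item_pairs K(1)] by (simp add: error_def)
    have upd: "(\<lambda>p. (p = y \<longrightarrow> b) \<and> p = y) = (\<lambda>_. False)(y := b)" for y :: "nat set" and b
      by (simp add: fun_eq_iff)
    have "Pi_pmf (?K x) False (\<lambda>_. bernoulli_pmf q) =
       bind_pmf (bernoulli_pmf q) (\<lambda>a. bind_pmf (bernoulli_pmf q) (\<lambda>b. return_pmf ((\<lambda>_. False)({x,v} := b, {0,x} := a))))"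
      using K(2) by (simp add: Pi_pmf_insert' Pi_pmf_singleton map_pmf_def bind_assoc_pmf bind_return_pmf upd)
    then have 2: "measure_pmf.expectation (Pi_pmf (?K x) False (\<lambda>_. bernoulli_pmf q)) (\<lambda>w. g (error w v x)) = (1 - 2 * q * (1 - q)) * g False + 2 * q * (1 - q) * g True"
      using K(2) assms(1,2)
      by (simp add: expectation_two_bernoulli error_def) (simp add: algebra_simps power2_eq_square)
    show ?thesis using 1 2 by simp
  qed
  have bound: "\<bar>g e\<bar> \<le> \<bar>g True\<bar> + \<bar>g False\<bar>" for e
    by (cases e) auto
  have "measure_pmf.expectation (noise q n) (\<lambda>w. \<Prod>x\<in>W. g (error w v x)) = (\<Prod>x\<in>W. measure_pmf.expectation (noise q n) (\<lambda>w. g (error w v x)))"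
    using ind fin
    by (intro prob_space.indep_vars_lebesgue_integral[OF prob_space_measure_pmf])
      (auto intro!: measure_pmf.integrable_const_bound[where B = "\<bar>g True\<bar> + \<bar>g False\<bar>"] AE_I2 bound)
  also have "\<dots> = ((1 - 2 * q * (1 - q)) * g False + 2 * q * (1 - q) * g True) ^ card W"
    by (simp add: one)
  finally show ?thesis .
qed


text \<open>
  Markov's inequality for \<open>r\<close> to the power (number of errors minus number of non-errors); the choice
  \<open>r = sqrt ((1 - p) / p)\<close> minimises its mean.
\<close>

lemma prob_many_errors:
  fixes W :: "nat set"
  assumes q: "0 < q" "q < 1 / 2" and v: "0 < v" "v < n" and W: "W \<subseteq> {1..<n} - {v}"
  defines "p \<equiv> 2 * q * (1 - q)"
  shows "measure_pmf.prob (noise q n) {w. card W \<le> 2 * card {x \<in> W. error w v x} + a} \<le>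
    sqrt ((1 - p) / p) ^ a * (2 * sqrt (p * (1 - p))) ^ card W"
proof -
  define r where "r = sqrt ((1 - p) / p)"
  define g where "g = (\<lambda>e. if e then r else 1 / r)"
  have fin: "finite W" using W finite_subset by blast
  \<comment> \<open>This square equals \<open>1 - 2 * p\<close>, whence
    \<open>p < 1 / 2\<close>.\<close>
  have "(1 - 2 * q) ^ 2 > 0" using q by simp
  then have p: "0 < p" "p < 1 / 2" using q by (simp_all add: p_def power2_eq_square algebra_simps)
  have r: "r \<ge> 1" using p by (simp add: r_def field_simps)
  have mean: "(1 - p) * g False + p * g True = 2 * sqrt (p * (1 - p))"
  proof -
    define a b where "a = sqrt p" and "b = sqrt (1 - p)"
    have ab: "a > 0" "b > 0" "p = a * a" "1 - p = b * b" using p by (simp_all add: a_def b_def)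
    have "sqrt (p * (1 - p)) = a * b" "r = b / a"
      by (simp_all add: r_def real_sqrt_divide real_sqrt_mult a_def b_def)
    moreover have "p * (b / a) = a * b" "(1 - p) / (b / a) = a * b"
      using ab(1,2) unfolding ab(4) by (simp_all add: ab(3))
    ultimately show ?thesis by (simp add: g_def)
  qed
  \<comment> \<open>The product is \<open>r\<close> to the power errors minus non-errors, and the
    event says that there are at most \<open>a\<close> more non-errors than errors.\<close>
  have ge: "1 / r ^ a \<le> (\<Prod>x\<in>W. g (error w v x))" if "card W \<le> 2 * card {x \<in> W. error w v x} + a" for w
  proof -
    let ?Z = "{x \<in> W. error w v x}" and ?C = "{x \<in> W. \<not> error w v x}"
    have "(\<Prod>x\<in>W. g (error w v x)) = r ^ card ?Z * (1 / r) ^ card ?C"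
      using fin by (simp add: g_def prod.If_cases Int_def Collect_neg_eq flip: Collect_conj_eq)
    moreover have "card W = card ?Z + card ?C"
      using fin by (subst card_Un_disjoint[symmetric]) (auto intro: arg_cong[where f = card])
    then have "r ^ card ?C \<le> r ^ (card ?Z + a)"
      using that r by (intro power_increasing) auto
    then have "1 / r ^ a \<le> r ^ card ?Z * (1 / r) ^ card ?C"
      using r by (simp add: field_simps power_add)
    ultimately show ?thesis by simp
  qed
  have int: "integrable (measure_pmf (noise q n)) (\<lambda>w. \<Prod>x\<in>W. g (error w v x))"
  proof (rule measure_pmf.integrable_const_bound[where B = "r ^ card W"])
    have "\<bar>g e\<bar> \<le> r" for e
    proof -
      have "1 / r \<le> 1" using r by simp
      then have "1 / r \<le> r" using r by linarith
      then show ?thesis using r by (simp add: g_def)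
    qed
    then have "\<bar>\<Prod>x\<in>W. g (error w v x)\<bar> \<le> r ^ card W" for w
      using prod_mono[of W "\<lambda>x. \<bar>g (error w v x)\<bar>" "\<lambda>_. r"] by (simp add: abs_prod)
    then show "AE w in measure_pmf (noise q n). norm (\<Prod>x\<in>W. g (error w v x)) \<le> r ^ card W"
      by simp
  qed simp
  have "measure_pmf.prob (noise q n) {w. card W \<le> 2 * card {x \<in> W. error w v x} + a} \<le>
      measure_pmf.prob (noise q n) {w. 1 / r ^ a \<le> (\<Prod>x\<in>W. g (error w v x))}"
    using ge by (intro measure_pmf.finite_measure_mono) auto
  also have "\<dots> \<le> measure_pmf.expectation (noise q n) (\<lambda>w. \<Prod>x\<in>W. g (error w v x)) / (1 / r ^ a)"
    using integral_Markov_inequality_measure[OF int, of UNIV "1 / r ^ a"] r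
    by (simp add: g_def prod_nonneg)
  also have "\<dots> = r ^ a * (2 * sqrt (p * (1 - p))) ^ card W"
    using expectation_error[of q v n W g] q v W mean by (simp add: p_def)
  finally show ?thesis by (simp add: r_def)
qed

text \<open>For \<open>x \<noteq> v\<close> the replies disagree iff exactly one of
  \<open>f v \<noteq> f 0\<close> and \<open>error w v x\<close> holds. The sample
  \<open>x = v\<close> makes one invalid query and may count either way; the margin \<open>2\<close>
  absorbs it.\<close>

lemma disagreements_reply:
  assumes "v < n" "m < n" "0 < v"
    and few: "2 * card {x \<in> {1..m} - {v}. error w v x} + 2 < m"
  shows "2 * disagreements n (reply f w) v {1..m} < m \<longleftrightarrow> f v = f 0"
proof -
  let ?W = "{1..m} - {v}"
  let ?D = "\<lambda>x. (x \<in> {0<..<n} \<and> reply f w 0 x) \<noteq> (x < n \<and> x \<noteq> v \<and> reply f w x v)"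
  let ?E = "{x \<in> ?W. error w v x}"
  have D: "?D x \<longleftrightarrow> (f v \<noteq> f 0) \<noteq> error w v x" if "x \<in> ?W" for x
    using that assms by (cases "f v"; cases "f 0"; cases "f x") (auto simp: reply_def error_def)
  have "finite ?E" by simp
  show ?thesis
  proof (cases "f v = f 0")
    case True
    have "{x \<in> {1..m}. ?D x} \<subseteq> insert v ?E" using D True by blast
    then have "disagreements n (reply f w) v {1..m} \<le> card (insert v ?E)"
      unfolding disagreements_def by (rule card_mono[rotated]) simp
    also have "\<dots> \<le> card ?E + 1" by (simp add: card_insert_if)
    finally show ?thesis using True few by simp
  next
    case False
    have "?W - ?E \<subseteq> {x \<in> {1..m}. ?D x}" using D False by blast
    then have "card (?W - ?E) \<le> disagreements n (reply f w) v {1..m}"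
      unfolding disagreements_def by (rule card_mono[rotated]) simp
    moreover have "card (?W - ?E) = card ?W - card ?E"
      by (rule card_Diff_subset) auto
    moreover have "card ?W \<ge> m - 1" by (simp add: card_Diff_singleton_if)
    ultimately show ?thesis using False few by simp
  qed
qed

text \<open>For \<open>v = 0\<close> both queries name the same pair and thus get the same
  persistent reply.\<close>

lemma disagreements_0: "m < n \<Longrightarrow> disagreements n (reply f w) 0 {1..m} = 0"
  by (auto simp: disagreements_def reply_def insert_commute)

lemma color_eq_iff: "f u = f v \<longleftrightarrow> (f u = f x) = (f v = f x)" for f :: "nat \<Rightarrow> color"
  by (cases "f u"; cases "f v"; cases "f x") auto

lemma recovers_cluster_code:
  assumes q: "0 < q" "q < 1 / 2" and m: "sample_size q n < n" "sample_size q n > 0"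
  defines "p \<equiv> 2 * q * (1 - q)"
  shows "measure_pmf.prob (execution cluster_code q n f (run_time n)) {k. recovers n f k} \<ge>
    1 - n * ((1 - p) / p * (2 * sqrt (p * (1 - p))) ^ (sample_size q n - 1))"
proof -
  let ?m = "sample_size q n"
  have q': "0 \<le> q" "q < 1" using q by auto
  define \<theta> where "\<theta> = 2 * sqrt (p * (1 - p))"
  have "(1 - 2 * q) ^ 2 > 0" using q by simp
  then have p: "0 < p" "p < 1 / 2" using q by (simp_all add: p_def power2_eq_square algebra_simps)
  have "p * (1 - p) \<le> (1 / 2) ^ 2" using sum_power2_ge_zero[of "p - 1/2" 0] by (simp add: power2_eq_square algebra_simps)
  then have "sqrt (p * (1 - p)) \<le> 1 / 2" by (rule real_le_lsqrt[rotated]) (use p in auto)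
  then have \<theta>: "0 \<le> \<theta>" "\<theta> \<le> 1" using p by (simp_all add: \<theta>_def)
  let ?N = "measure_pmf (noise q n)"
  \<comment> \<open>The slack \<open>2\<close> is the margin of \<open>disagreements_reply\<close>;
    stating the event with the set without \<open>v\<close> fits
    \<open>prob_many_errors\<close>.\<close>
  let ?bad = "\<lambda>v. {w. card ({1..?m} - {v}) \<le> 2 * card {x \<in> {1..?m} - {v}. error w v x} + 2}"
  obtain R where R: "execution cluster_code q n f (run_time n) = map_pmf (\<lambda>w. ([], R w)) (noise q n)"
    "\<And>w v. v < n \<Longrightarrow> heap (R w) v = of_bool (2 * disagreements n (reply f w) v {1..?m} < ?m)"
    using execution_cluster_code[OF q', of n f] by metis
  have good: "recovers n f ([], R w)" if "w \<notin> (\<Union>v\<in>{1..<n}. ?bad v)" for w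
  proof -
    have lab: "heap (R w) v = of_bool (f v = f 0)" if "v < n" for v
    proof (cases "v = 0")
      case True
      then show ?thesis using R(2)[OF that, of w] m disagreements_0[OF m(1)] by simp
    next
      case False
      have "w \<notin> ?bad v" using \<open>w \<notin> _\<close> that False by auto
      moreover have "card ({1..?m} - {v}) \<le> ?m"
        using card_Diff_subset_Int[of "{1..?m}" "{v}"] by (simp add: card_Diff_singleton_if)
      ultimately have "2 * card {x \<in> {1..?m} - {v}. error w v x} + 2 < ?m" by simp
      from disagreements_reply[OF that m(1) _ this] show ?thesis
        using R(2)[OF that, of w] False by simp
    qed
    show ?thesis
      unfolding recovers_def
    proof (intro allI impI)
      fix u v assume "u < n" "v < n"
      then show "heap (snd ([], R w)) u = heap (snd ([], R w)) v \<longleftrightarrow> f u = f v"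
        unfolding color_eq_iff[of f u v 0] by (simp add: lab)
    qed
  qed
  have bad: "measure ?N (?bad v) \<le> (1 - p) / p * \<theta> ^ (?m - 1)" if "v \<in> {1..<n}" for v
  proof -
    have "measure ?N (?bad v) \<le> sqrt ((1 - p) / p) ^ 2 * \<theta> ^ card ({1..?m} - {v})"
      unfolding p_def \<theta>_def using that m by (intro prob_many_errors q) auto
    also have "\<dots> = (1 - p) / p * \<theta> ^ card ({1..?m} - {v})" using p by simp
    also have "\<dots> \<le> (1 - p) / p * \<theta> ^ (?m - 1)"
      using \<theta> p by (intro mult_left_mono power_decreasing) (auto simp: card_Diff_singleton_if)
    finally show ?thesis .
  qed
  have "measure ?N (\<Union>v\<in>{1..<n}. ?bad v) \<le> (\<Sum>v\<in>{1..<n}. measure ?N (?bad v))"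
    by (rule measure_pmf.finite_measure_subadditive_finite) auto
  also have "\<dots> \<le> (\<Sum>v\<in>{1..<n}. (1 - p) / p * \<theta> ^ (?m - 1))"
    by (rule sum_mono[OF bad])
  also have "\<dots> \<le> n * ((1 - p) / p * \<theta> ^ (?m - 1))"
    unfolding sum_constant using p \<theta> by (intro mult_right_mono) auto
  finally have "1 - n * ((1 - p) / p * \<theta> ^ (?m - 1)) \<le> 1 - measure ?N (\<Union>v\<in>{1..<n}. ?bad v)"
    by simp
  also have "\<dots> = measure ?N (- (\<Union>v\<in>{1..<n}. ?bad v))"
    by (subst measure_pmf.prob_compl[symmetric]) (auto simp: Compl_eq_Diff_UNIV)
  also have "\<dots> \<le> measure ?N {w. recovers n f ([], R w)}"
    using good by (intro measure_pmf.finite_measure_mono) auto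
  also have "\<dots> = measure_pmf.prob (execution cluster_code q n f (run_time n)) {k. recovers n f k}"
    by (simp add: R(1) vimage_def)
  finally show ?thesis by (simp add: \<theta>_def)
qed

section \<open>Asymptotics of the sample size\<close>

lemma harm_le_ln:
  assumes "n > 0" shows "harm n \<le> ln (real n) + 1"
proof -
  have "harm n - ln (real n) \<le> harm 1 - ln (real 1)"
    using euler_mascheroni_sequence_decreasing[of 1 n] assms by simp
  then show ?thesis by (simp add: harm_def)
qed

lemma div_ge_real:
  assumes "b > 0" shows "real (a div b) > real a / real b - 1"
proof -
  have "a < (a div b + 1) * b"
    using assms by (metis Suc_eq_plus1 dividend_less_div_times mult.commute mult_Suc add.commute)
  then have "real a < real ((a div b + 1) * b)" by (rule of_nat_less_iff[THEN iffD2])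
  then show ?thesis using assms by (simp add: field_simps)
qed

lemma log_est_bounds:
  assumes "n > 0"
  shows "ln (real n) \<le> log_est n" and "log_est n \<le> ln (real n) + 3"
proof -
  let ?S = "\<Sum>i=1..n. n div i"
  have H: "n * harm n = (\<Sum>i=1..n. real n / real i)"
    by (simp add: harm_def sum_distrib_left divide_inverse)
  have le: "real ?S \<le> n * harm n"
    unfolding H of_nat_sum by (intro sum_mono of_nat_div_le_of_nat)
  have "n * harm n - n = (\<Sum>i=1..n. real n / real i - 1)"
    unfolding H by (simp add: sum_subtractf)
  also have "\<dots> \<le> real ?S"
    unfolding of_nat_sum by (intro sum_mono less_imp_le[OF div_ge_real]) auto
  finally have ge: "n * harm n - n \<le> real ?S" .
  have "harm n - 1 \<le> real ?S / real n" "real ?S / real n \<le> harm n"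
    using le ge assms by (simp_all add: field_simps)
  moreover have "real (?S div n) \<le> real ?S / real n" "real (?S div n) \<ge> real ?S / real n - 1"
    using div_ge_real[OF assms, of ?S] of_nat_div_le_of_nat[where 'a = real, of ?S n] by linarith+
  moreover have "real (log_est n) = real (?S div n) + 2" by (simp add: log_est_def)
  moreover have "ln (real n) \<le> ln (real n + 1)" using assms by simp
  ultimately show "ln (real n) \<le> log_est n" "log_est n \<le> ln (real n) + 3"
    using ln_le_harm[of n] harm_le_ln[OF assms] by linarith+
qed

lemma bias_bounds:
  fixes q :: real
  assumes "0 < q" "q < 1 / 2"
  shows "(1 - 2 * q) * scale n \<le> bias q n" and "bias q n \<le> (1 - 2 * q) * scale n + 2"
proof -
  let ?f = "\<lfloor>q * scale n\<rfloor>"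
  have f: "?f \<ge> 0" "real_of_int ?f \<le> q * scale n" "real_of_int ?f > q * scale n - 1"
    using assms by (simp, simp, linarith)
  \<comment> \<open>This keeps the subtraction in \<open>bias\<close> from being truncated.\<close>
  have "q * scale n \<le> (1/2) * scale n" using assms by (intro mult_right_mono) auto
  then have "2 * real (nat ?f) \<le> scale n" using f(1,2) by linarith
  then have "2 * nat ?f \<le> scale n" by linarith
  then have "real (bias q n) = scale n - 2 * real_of_int ?f"
    using f by (simp add: bias_def of_nat_diff)
  moreover have "(1 - 2 * q) * scale n = scale n - 2 * (q * scale n)"
    by (simp add: algebra_simps)
  ultimately show "(1 - 2 * q) * scale n \<le> bias q n" "bias q n \<le> (1 - 2 * q) * scale n + 2"
    using f(2,3) by linarith+
qed

lemma damped_le_power: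
  fixes q :: real
  assumes "0 < q" "q < 1 / 2"
  shows "damped q n i \<le> scale n * (1 - 2 * q + 2 / scale n) ^ i"
proof (induction i)
  case (Suc i)
  let ?N = "scale n"
  have N: "real ?N > 0" using scale_pos[of n] by simp
  have "real (damped q n (Suc i)) \<le> real (damped q n i * bias q n) / ?N"
    by (simp add: of_nat_div_le_of_nat del: of_nat_mult)
  also have "\<dots> = damped q n i * (bias q n / ?N)" by simp
  also have "\<dots> \<le> (?N * (1 - 2 * q + 2 / ?N) ^ i) * (1 - 2 * q + 2 / ?N)"
    using bias_bounds(2)[OF assms, of n] N assms
    by (intro mult_mono Suc) (auto simp: field_simps)
  finally show ?case by (simp add: mult_ac)
qed simp

text \<open>Each rounding loses at most \<open>1\<close> and later factors shrink old losses by
  \<open>1 - 2 * q\<close>, so the total loss is at most the geometric series with sum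
  \<open>1 / (2 * q)\<close>.\<close>

lemma damped_ge_power:
  fixes q :: real
  assumes "0 < q" "q < 1 / 2"
  shows "damped q n i \<ge> scale n * (1 - 2 * q) ^ i - 1 / (2 * q)"
proof (induction i)
  case 0
  then show ?case using assms by simp
next
  case (Suc i)
  let ?N = "scale n"
  have N: "real ?N > 0" using scale_pos[of n] by simp
  have "?N * (1 - 2 * q) ^ Suc i - 1 / (2 * q) = (?N * (1 - 2 * q) ^ i - 1 / (2 * q)) * (1 - 2 * q) - 1"
    using assms by (simp add: field_simps)
  also have "\<dots> \<le> damped q n i * (bias q n / ?N) - 1"
  proof -
    have "(?N * (1 - 2 * q) ^ i - 1 / (2 * q)) * (1 - 2 * q) \<le> damped q n i * (1 - 2 * q)"
      using Suc assms by (intro mult_right_mono) auto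
    also have "\<dots> \<le> damped q n i * (bias q n / ?N)"
      using bias_bounds(1)[OF assms, of n] N by (intro mult_left_mono) (auto simp: field_simps)
    finally show ?thesis by simp
  qed
  also have "\<dots> = real (damped q n i * bias q n) / ?N - 1" by simp
  also have "\<dots> \<le> damped q n (Suc i)"
    using div_ge_real[OF scale_pos, of "damped q n i * bias q n" n] by simp
  finally show ?case .
qed

lemma clog_bounds:
  assumes "n > 1" "b > 1"
  shows "ln (real n) / ln (real b) \<le> clog b n" and "clog b n \<le> ln (real n) / ln (real b) + 1"
proof -
  have lb: "ln (real b) > 0" using assms by simp
  have "real n \<le> real (b ^ clog b n)" using le_power_clog[of b n] assms by (simp only: of_nat_le_iff)
  then have "ln (real n) \<le> ln (real b ^ clog b n)" using assms by simp
  also have "\<dots> = clog b n * ln (real b)" using assms by (simp add: ln_realpow)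
  finally show "ln (real n) / ln (real b) \<le> clog b n" using lb by (simp add: field_simps)
  show "clog b n \<le> ln (real n) / ln (real b) + 1"
  proof (cases "clog b n")
    case 0
    then show ?thesis using assms lb by simp
  next
    case (Suc k)
    then have "b ^ k < n" by (intro power_less_clog) simp
    then have "real (b ^ k) < real n" by (simp only: of_nat_less_iff)
    then have "ln (real b ^ k) \<le> ln (real n)" using assms by simp
    then have "k * ln (real b) \<le> ln (real n)" using assms by (simp add: ln_realpow)
    then show ?thesis using lb Suc by (simp add: field_simps)
  qed
qed

text \<open>With \<open>b = log_est n\<close>, \<open>ln b\<close> exceeds \<open>ln (ln n)\<close>
  by at most \<open>3 / ln n\<close>. After multiplication by \<open>ln n\<close> this shifts the
  quotient by at most \<open>3 / (ln (ln n) * ln b) \<le> 3\<close>; rounding up adds at most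
  \<open>1\<close>.\<close>

lemma clog_log_est_bounds:
  fixes r :: real
  assumes "n > 1" "ln (ln (real n)) \<ge> 1"
  defines "r \<equiv> ln (real n) / ln (ln (real n))"
  shows "r - 3 \<le> clog (log_est n) n" and "clog (log_est n) n \<le> r + 1"
proof -
  let ?l = "ln (real n)" and ?b = "real (log_est n)"
  have l: "?l > 0" using assms by simp
  have lb: "ln ?l \<le> ln ?b"
    using log_est_bounds(1)[of n] log_est_ge_2[of n] assms(1) l by (subst ln_le_cancel_iff) auto
  have "?l * (3 / ?l) = 3" using l by simp
  then have eq: "?l * (1 + 3 / ?l) = ?l + 3" by (simp only: distrib_left mult_1_right)
  have "ln ?b \<le> ln (?l * (1 + 3 / ?l))"
    unfolding eq using log_est_bounds(2)[of n] log_est_ge_2[of n] l assms(1)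
    by (subst ln_le_cancel_iff) auto
  also have "\<dots> = ln ?l + ln (1 + 3 / ?l)"
  proof -
    have "1 + 3 / ?l > 0" using l by (simp add: add_pos_pos)
    then show ?thesis using l by (intro ln_mult_pos) auto
  qed
  also have "\<dots> \<le> ln ?l + 3 / ?l" using l ln_add_one_self_le_self[of "3 / ?l"] by simp
  finally have ub: "ln ?b \<le> ln ?l + 3 / ?l" .
  have b: "ln ?b \<ge> 1" using lb assms(2) by linarith
  have pos: "ln ?l * ln ?b > 0" using b assms(2) by (intro mult_pos_pos) linarith+
  have "r - ?l / ln ?b = ?l * (ln ?b - ln ?l) / (ln ?l * ln ?b)"
    using lb assms(2) by (simp add: r_def field_simps)
  also have "\<dots> \<le> 3 / (ln ?l * ln ?b)"
  proof (rule divide_right_mono)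
    show "?l * (ln ?b - ln ?l) \<le> 3" using ub l by (simp add: field_simps)
    show "0 \<le> ln ?l * ln ?b" using pos by simp
  qed
  also have "\<dots> \<le> 3 / (1 * 1)"
    using b pos assms(2) by (intro divide_left_mono mult_mono) (auto simp: mult.commute)
  finally have 1: "r - 3 \<le> ?l / ln ?b" by simp
  have 2: "?l / ln ?b \<le> r"
    unfolding r_def using lb pos l by (intro divide_left_mono) (auto simp: mult.commute)
  show "r - 3 \<le> clog (log_est n) n" "clog (log_est n) n \<le> r + 1"
    using clog_bounds[of n "log_est n"] 1 2 assms(1) log_est_ge_2[of n] by auto
qed

text \<open>The query bound divided by \<open>n\<close>, on real arguments so that limits at
  infinity apply.\<close>

definition rate :: "real \<Rightarrow> real \<Rightarrow> real" where
  "rate d x = ln x * d powr (- (ln x / ln (ln x)))"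

lemma power_clog_bounds:
  fixes d r :: real
  assumes "n > 1" "ln (ln (real n)) \<ge> 1" "0 < d" "d < 1"
  defines "r \<equiv> ln (real n) / ln (ln (real n))"
  shows "d powr (r + 1) \<le> d ^ clog (log_est n) n" and "d ^ clog (log_est n) n \<le> d powr (r - 3)"
  using clog_log_est_bounds[OF assms(1,2)] assms(3,4)
  by (auto simp: r_def powr_mono' simp flip: powr_realpow)

lemma sample_size_upper:
  fixes q d :: real
  assumes q: "0 < q" "q < 1 / 2" and n: "n > 1" "ln (ln (real n)) \<ge> 1"
  defines "d \<equiv> 1 - 2 * q"
  assumes big: "real n * d powr (ln (real n) / ln (ln (real n)) + 1) \<ge> 1 / q"
  shows "sample_size q n \<le> 8 / d * rate d (real n)"
proof -
  define r where "r = ln (real n) / ln (ln (real n))"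
  let ?N = "real (scale n)" and ?m = "clog (log_est n) n" and ?D = "real (damped q n (clog (log_est n) n))"
  have d: "0 < d" "d < 1" using q by (simp_all add: d_def)
  have l: "ln (real n) \<ge> 1"
  proof -
    have "ln (real n) = exp (ln (ln (real n)))" using n by simp
    then show ?thesis using exp_ge_add_one_self[of "ln (ln (real n))"] n by linarith
  qed
  have N: "?N \<ge> n" "?N > 0" using scale_ge[of n] scale_pos[of n] by simp_all
  have p: "d powr (r + 1) \<le> d ^ ?m"
    using power_clog_bounds(1)[OF n d] by (simp add: r_def)
  have large: "1 / q \<le> ?N * d ^ ?m"
    using big p N d by (intro order.trans[OF big] mult_mono) (auto simp: r_def)
  have "?N * d ^ ?m - 1 / (2 * q) \<le> ?D"
    using damped_ge_power[OF q, of n ?m] by (simp add: d_def)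
  moreover have "1 / (2 * q) = (1 / q) / 2" by simp
  \<comment> \<open>By \<open>large\<close>, the rounding loss \<open>1 / (2 * q)\<close> is at most
    half of the exact value.\<close>
  ultimately have D: "?N * d ^ ?m / 2 \<le> ?D + 1" using large by linarith
  have "real (sample_size q n) \<le> log_est n * ?N / (?D + 1)"
    unfolding sample_size_def using of_nat_div_le_of_nat[where 'a = real, of "log_est n * scale n" "damped q n ?m + 1"]
    by (simp add: algebra_simps)
  also have "\<dots> \<le> log_est n * ?N / (?N * d ^ ?m / 2)"
    using D N d by (intro divide_left_mono mult_pos_pos) auto
  also have "\<dots> = 2 * log_est n / d ^ ?m" using N by simp
  \<comment> \<open>Since \<open>ln n \<ge> 1\<close>,
    \<open>log_est n \<le> ln n + 3 \<le> 4 * ln n\<close>.\<close>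
  also have "\<dots> \<le> (8 * ln (real n)) / d powr (r + 1)"
    using log_est_bounds(2)[of n] n l p d by (intro frac_le) auto
  also have "\<dots> = 8 / d * rate d (real n)"
    using d by (simp add: rate_def r_def powr_add powr_minus field_simps)
  finally show ?thesis .
qed

lemma sample_size_lower:
  fixes q d :: real
  assumes q: "0 < q" "q < 1 / 2" and n: "n > 1" "ln (ln (real n)) \<ge> 1"
  defines "d \<equiv> 1 - 2 * q"
  assumes big: "real n * d powr (ln (real n) / ln (ln (real n)) + 1) \<ge> 1"
  shows "sample_size q n \<ge> d ^ 3 / (exp (2 / d) + 1) * rate d (real n) - 1"
proof -
  define r where "r = ln (real n) / ln (ln (real n))"
  define K where "K = exp (2 / d)"
  let ?N = "real (scale n)" and ?m = "clog (log_est n) n" and ?D = "real (damped q n (clog (log_est n) n))"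
  have d: "0 < d" "d < 1" using q by (simp_all add: d_def)
  have N: "?N \<ge> n" "?N > 0" using scale_ge[of n] scale_pos[of n] by simp_all
  have p: "d powr (r + 1) \<le> d ^ ?m" "d ^ ?m \<le> d powr (r - 3)"
    using power_clog_bounds[OF n d] by (simp_all add: r_def)
  have one: "1 \<le> ?N * d ^ ?m"
    using big p N d by (intro order.trans[OF big] mult_mono) (auto simp: r_def)
  have "(d + 2 / ?N) ^ ?m = (d * (1 + 2 / (d * ?N))) ^ ?m"
    using d by (simp add: field_simps)
  also have "\<dots> = d ^ ?m * (1 + 2 / (d * ?N)) ^ ?m" by (rule power_mult_distrib)
  \<comment> \<open>The excess \<open>2 / ?N\<close> per factor is harmless: there are at most
    \<open>n \<le> ?N\<close> factors, so together they contribute at most the constant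
    \<open>exp (2 / d)\<close>.\<close>
  also have "(1 + 2 / (d * ?N)) ^ ?m \<le> exp (2 / (d * ?N)) ^ ?m"
    using d N by (intro power_mono exp_ge_add_one_self) (auto intro!: add_nonneg_nonneg)
  also have "\<dots> = exp (?m * (2 / (d * ?N)))" by (rule exp_of_nat_mult[symmetric])
  also have "\<dots> \<le> K"
  proof -
    have "real ?m \<le> ?N" using clog_le[OF log_est_ge_2, of n n] N by linarith
    then have "?m * (2 / (d * ?N)) \<le> ?N * (2 / (d * ?N))"
      using d N by (intro mult_right_mono) auto
    then show ?thesis using N by (simp add: K_def)
  qed
  finally have pow: "(d + 2 / ?N) ^ ?m \<le> d ^ ?m * K" using d by simp
  have "?D \<le> ?N * (d + 2 / ?N) ^ ?m"
    using damped_le_power[OF q, of n ?m] by (simp add: d_def)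
  also have "\<dots> \<le> ?N * (d ^ ?m * K)" using pow N by (intro mult_left_mono) auto
  finally have D: "?D + 1 \<le> ?N * d ^ ?m * (K + 1)" using one by (simp add: algebra_simps)
  have "d ^ 3 / (K + 1) * rate d (real n) = ln (real n) / (d powr (r - 3) * (K + 1))"
    using d by (simp add: rate_def r_def powr_diff powr_minus field_simps powr_numeral)
  also have "\<dots> \<le> log_est n / (d ^ ?m * (K + 1))"
    using log_est_bounds(1)[of n] n p d by (intro frac_le mult_right_mono) (auto simp: K_def add_pos_pos)
  also have "\<dots> = log_est n * ?N / (?N * d ^ ?m * (K + 1))"
    using N by simp
  also have "\<dots> \<le> log_est n * ?N / (?D + 1)"
    using D N d by (intro divide_left_mono mult_pos_pos) (auto simp: K_def add_pos_pos)
  also have "\<dots> \<le> sample_size q n + 1"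
    using div_ge_real[of "damped q n ?m + 1" "log_est n * scale n"] unfolding sample_size_def
    by (simp add: algebra_simps)
  finally show ?thesis by (simp add: K_def)
qed

text \<open>The exponent \<open>ln x / ln (ln x)\<close> tends to infinity but is
  \<open>o(ln x)\<close>, so the power of \<open>d\<close> in \<open>rate\<close> grows without
  bound yet more slowly than any positive power of \<open>x\<close>.\<close>

lemma rate_asymps:
  fixes d C :: real
  assumes "0 < d" "d < 1" "0 < C"
  shows "eventually (\<lambda>x::real. ln (ln x) \<ge> 1) at_top"
    "eventually (\<lambda>x. x * d powr (ln x / ln (ln x) + 1) \<ge> C) at_top"
    "eventually (\<lambda>x. C * rate d x < x) at_top"
    "eventually (\<lambda>x. rate d x \<ge> C * (ln x + 1)) at_top"
proof -
  define L where "L = - ln d"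
  have L: "L > 0" using assms by (simp add: L_def)
  have d: "d powr y = exp (- L * y)" for y using assms by (simp add: powr_def L_def)
  show "eventually (\<lambda>x::real. ln (ln x) \<ge> 1) at_top" by real_asymp
  show "eventually (\<lambda>x. x * d powr (ln x / ln (ln x) + 1) \<ge> C) at_top"
    unfolding d using L assms by real_asymp
  show "eventually (\<lambda>x. C * rate d x < x) at_top"
    unfolding d rate_def using L assms by real_asymp
  show "eventually (\<lambda>x. rate d x \<ge> C * (ln x + 1)) at_top"
    unfolding d rate_def using L assms by real_asymp
qed


lemma eventually_sample_size:
  fixes q d :: real
  assumes q: "0 < q" "q < 1 / 2"
  defines "d \<equiv> 1 - 2 * q"
  obtains C1 C2 where "C1 > 0" "C2 > 0"
    "\<forall>\<^sub>F n in sequentially. C1 * rate d (real n) \<le> sample_size q n \<and> sample_size q n \<le> C2 * rate d (real n)"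
proof
  have d: "0 < d" "d < 1" using q by (simp_all add: d_def)
  define C where "C = d ^ 3 / (exp (2 / d) + 1)"
  show "C / 2 > 0" "8 / d > 0" using d by (auto simp: C_def intro!: divide_pos_pos add_pos_pos)
  note ev = eventually_compose_filterlim[OF _ filterlim_real_sequentially]
  have "1 / q > 0" "2 / C > 0" using q \<open>C / 2 > 0\<close> by simp_all
  note A = rate_asymps[OF d this(1)] and B = rate_asymps[OF d this(2)]
  show "\<forall>\<^sub>F n in sequentially. C / 2 * rate d (real n) \<le> sample_size q n \<and>
      sample_size q n \<le> 8 / d * rate d (real n)"
    using eventually_gt_at_top[of 1] ev[OF A(1)] ev[OF A(2)] ev[OF B(4)]
  proof eventually_elim
    case (elim n)
    \<comment> \<open>The largeness condition for the upper bound thus implies the one for the lower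
      bound.\<close>
    have "1 / q \<ge> 1" using q by simp
    have "ln (real n) \<ge> 0" using elim by simp
    have "2 / C * 1 \<le> 2 / C * (ln (real n) + 1)"
      using \<open>2 / C > 0\<close> \<open>ln (real n) \<ge> 0\<close> by (intro mult_left_mono) auto
    \<comment> \<open>From here on, half of \<open>C * rate d n\<close> absorbs the
      \<open>- 1\<close> left by the final division.\<close>
    then have "2 / C \<le> rate d (real n)" using elim by linarith
    then have "C / 2 * rate d (real n) \<ge> 1" using \<open>C / 2 > 0\<close> by (simp add: field_simps)
    moreover have "sample_size q n \<ge> C * rate d (real n) - 1"
      using sample_size_lower[OF q, of n] elim \<open>1 / q \<ge> 1\<close> unfolding C_def d_def[symmetric] by linarith
    moreover have "sample_size q n \<le> 8 / d * rate d (real n)"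
      using sample_size_upper[OF q, of n] elim unfolding d_def[symmetric] by linarith
    ultimately show ?case by linarith
  qed
qed

lemma eventually_sample_size_less:
  fixes q :: real
  assumes "0 < q" "q < 1 / 2"
  shows "\<forall>\<^sub>F n in sequentially. sample_size q n < n"
proof -
  obtain C1 C2 where C: "C1 > 0" "C2 > 0"
    "\<forall>\<^sub>F n in sequentially. C1 * rate (1 - 2 * q) (real n) \<le> sample_size q n \<and>
      sample_size q n \<le> C2 * rate (1 - 2 * q) (real n)"
    using eventually_sample_size[OF assms] by blast
  have "\<forall>\<^sub>F x in at_top. C2 * rate (1 - 2 * q) x < x"
    using assms C(2) by (intro rate_asymps) auto
  from eventually_compose_filterlim[OF this filterlim_real_sequentially] C(3) show ?thesis
    by eventually_elim linarith
qed

lemma eventually_sample_size_ge_ln: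
  fixes q C :: real
  assumes "0 < q" "q < 1 / 2" "C \<ge> 1"
  shows "\<forall>\<^sub>F n in sequentially. sample_size q n \<ge> C * (ln (real n) + 1)"
proof -
  obtain C1 C2 where C: "C1 > 0" "C2 > 0"
    "\<forall>\<^sub>F n in sequentially. C1 * rate (1 - 2 * q) (real n) \<le> sample_size q n \<and>
      sample_size q n \<le> C2 * rate (1 - 2 * q) (real n)"
    using eventually_sample_size[OF assms(1,2)] by blast
  have "\<forall>\<^sub>F x in at_top. rate (1 - 2 * q) x \<ge> C / C1 * (ln x + 1)"
    using assms C(1) by (intro rate_asymps) auto
  from eventually_compose_filterlim[OF this filterlim_real_sequentially] C(3) show ?thesis
  proof eventually_elim
    case (elim n)
    have "C * (ln (real n) + 1) = C1 * (C / C1 * (ln (real n) + 1))" using C(1) by simp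
    also have "\<dots> \<le> C1 * rate (1 - 2 * q) (real n)" using elim C(1) by (intro mult_left_mono) auto
    finally show ?case using elim by linarith
  qed
qed

lemma query_complexity_cluster_code:
  fixes q :: real
  assumes q: "0 < q" "q < 1 / 2"
  shows "query_complexity cluster_code q run_time (\<lambda>n. real n * rate (1 - 2 * q) (real n))"
  unfolding query_complexity_def
proof (intro allI impI)
  fix f k
  assume k: "\<forall>n. k n \<in> set_pmf (execution cluster_code q n (f n) (run_time n))"
  let ?r = "\<lambda>n. rate (1 - 2 * q) (real n)"
  have q': "0 \<le> q" "q < 1" using q by auto
  obtain C1 C2 where C: "C1 > 0" "C2 > 0"
    "\<forall>\<^sub>F n in sequentially. C1 * ?r n \<le> sample_size q n \<and> sample_size q n \<le> C2 * ?r n"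
    using eventually_sample_size[OF q] by blast
  show "(\<lambda>n. real (num_queries (k n))) \<in> \<Theta>(\<lambda>n. real n * ?r n)"
  \<comment> \<open>The factor \<open>2\<close> in the upper constant comes from the two queries per
    sample.\<close>
  proof (rule bigthetaI'[OF C(1)])
    show "2 * C2 > 0" using C(2) by simp
    show "\<forall>\<^sub>F n in sequentially. C1 * norm (real n * ?r n) \<le> norm (real (num_queries (k n))) \<and>
        norm (real (num_queries (k n))) \<le> 2 * C2 * norm (real n * ?r n)"
      using C(3) eventually_sample_size_less[OF q] eventually_gt_at_top[of 1]
    proof eventually_elim
      case (elim n)
      have "?r n \<ge> 0" using elim(3) by (simp add: rate_def)
      have "num_queries (k n) \<in> {sample_size q n * n..2 * sample_size q n * n}"
        using k elim(2) by (intro num_queries_cluster_code[OF q']) auto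
      then have "real (sample_size q n * n) \<le> num_queries (k n)"
        "num_queries (k n) \<le> real (2 * sample_size q n * n)"
        unfolding of_nat_le_iff by simp_all
      moreover have "C1 * ?r n * n \<le> sample_size q n * real n" "sample_size q n * real n \<le> C2 * ?r n * n"
        using elim(1) by (auto intro!: mult_right_mono)
      ultimately show ?case using \<open>?r n \<ge> 0\<close> by (simp add: mult_ac)
    qed
  qed
qed

lemma recovers_whp_cluster_code:
  fixes q :: real
  assumes q: "0 < q" "q < 1 / 2"
  shows "recovers_whp cluster_code q run_time"
  unfolding recovers_whp_def
proof
  fix f :: "nat \<Rightarrow> nat \<Rightarrow> color"
  let ?P = "\<lambda>n. measure_pmf.prob (execution cluster_code q n (f n) (run_time n)) {k. recovers n (f n) k}"
  define p where "p = 2 * q * (1 - q)"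
  define \<theta> where "\<theta> = 2 * sqrt (p * (1 - p))"
  have sq: "(1 - 2 * q) ^ 2 > 0" using q by simp
  then have p: "0 < p" "p < 1 / 2" using q by (simp_all add: p_def power2_eq_square algebra_simps)
  \<comment> \<open>Strictness matters: it gives \<open>\<theta> < 1\<close> and so exponential
    decay.\<close>
  have "(p - 1 / 2) ^ 2 > 0" using p by simp
  then have "p * (1 - p) < (1 / 2) ^ 2" by (simp add: power2_eq_square algebra_simps)
  then have "sqrt (p * (1 - p)) < sqrt ((1 / 2) ^ 2)" by (rule real_sqrt_less_mono)
  then have "sqrt (p * (1 - p)) < 1 / 2" unfolding real_sqrt_abs by simp
  then have \<theta>: "0 < \<theta>" "\<theta> < 1" using p by (simp_all add: \<theta>_def)
  then have "ln \<theta> < 0" by simp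
  \<comment> \<open>Chosen so that \<open>\<theta>\<close> to the power \<open>C * ln n\<close> is
    at most \<open>n\<close> to the power \<open>-2\<close>; the union bound over \<open>n\<close>
    items then leaves a multiple of \<open>1 / n\<close>.\<close>
  define C where "C = max 1 (2 / - ln \<theta>)"
  have "C \<ge> 1" "C * ln \<theta> \<le> -2"
    using \<open>ln \<theta> < 0\<close> by (auto simp: C_def max_def field_simps)
  have lower: "\<forall>\<^sub>F n in sequentially. 1 - (1 - p) / p * (1 / real n) \<le> ?P n"
    using eventually_sample_size_ge_ln[OF q \<open>C \<ge> 1\<close>] eventually_sample_size_less[OF q] eventually_gt_at_top[of 1]
  proof eventually_elim
    case (elim n)
    let ?m = "sample_size q n"
    have "ln (real n) > 0" using elim(3) by simp
    have "C * ln (real n) \<ge> 0" using \<open>C \<ge> 1\<close> \<open>ln (real n) > 0\<close> by simp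
    \<comment> \<open>The extra summand \<open>C \<ge> 1\<close> pays for the exponent
      \<open>?m - 1\<close>.\<close>
    have m: "real ?m \<ge> C * ln (real n) + C" using elim(1) by (simp add: algebra_simps)
    then have "real ?m \<ge> 1" using \<open>C \<ge> 1\<close> \<open>C * ln (real n) \<ge> 0\<close> by linarith
    then have "?m > 0" by simp
    have "real (?m - 1) \<ge> C * ln (real n)" using m \<open>?m > 0\<close> \<open>C \<ge> 1\<close> by simp
    then have "real (?m - 1) * ln \<theta> \<le> C * ln (real n) * ln \<theta>"
      using \<open>ln \<theta> < 0\<close> by (intro mult_right_mono_neg) auto
    also have "\<dots> = C * ln \<theta> * ln (real n)" by simp
    also have "\<dots> \<le> -2 * ln (real n)"
      using \<open>C * ln \<theta> \<le> -2\<close> \<open>ln (real n) > 0\<close> by (intro mult_right_mono) auto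
    finally have "exp (real (?m - 1) * ln \<theta>) \<le> exp (- 2 * ln (real n))" by simp
    also have "exp (real (?m - 1) * ln \<theta>) = \<theta> ^ (?m - 1)"
      using \<theta> by (simp add: exp_of_nat_mult)
    also have "exp (- 2 * ln (real n)) = 1 / (real n * real n)"
    proof -
      have "exp (- 2 * ln (real n)) = exp (- ln (real n)) * exp (- ln (real n))"
        by (simp flip: exp_add)
      then show ?thesis using elim(3) by (simp add: exp_minus field_simps)
    qed
    finally have "real n * ((1 - p) / p * \<theta> ^ (?m - 1)) \<le> real n * ((1 - p) / p * (1 / (real n * real n)))"
      using p by (intro mult_left_mono) auto
    also have "\<dots> = (1 - p) / p * (1 / real n)" using elim(3) by simp
    finally show ?case
      using recovers_cluster_code[OF q elim(2) \<open>?m > 0\<close>, of "f n"] unfolding p_def \<theta>_def by linarith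
  qed
  have "(\<lambda>n. 1 - (1 - p) / p * (1 / real n)) \<longlonglongrightarrow> 1 - (1 - p) / p * 0"
    by (intro tendsto_intros lim_1_over_n)
  then have lim: "(\<lambda>n. 1 - (1 - p) / p * (1 / real n)) \<longlonglongrightarrow> 1" by simp
  show "?P \<longlonglongrightarrow> 1"
    by (rule tendsto_sandwich[OF lower _ lim tendsto_const]) simp
qed

theorem theorem1:
  fixes q c :: real
  assumes "0 < q" and "q < 1 / 2" and "c = 1 / 2 - q"
  shows "\<exists>P t. poly_time P q t \<and>
    query_complexity P q t
      (\<lambda>n. real n * ln (real n) * (2 * c) powr (- (ln (real n) / ln (ln (real n))))) \<and>
    recovers_whp P q t"
proof -
  have "2 * c = 1 - 2 * q" using assms(3) by simp
  then have "query_complexity cluster_code q run_time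
      (\<lambda>n. real n * ln (real n) * (2 * c) powr (- (ln (real n) / ln (ln (real n)))))"
    using query_complexity_cluster_code[OF assms(1,2)] by (simp add: rate_def mult.assoc)
  moreover have "poly_time cluster_code q run_time"
    using assms by (intro poly_time_cluster_code) auto
  ultimately show ?thesis using recovers_whp_cluster_code[OF assms(1,2)] by blast
qed

end
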